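(* Let $t>0$, $x\in\mathbb R$, $0<\underline c<\overline c<\infty$, and let $X(\omega)=\{u_c(x,t,\omega):\underline c\le c\le\overline c\}$, where $u_c(x,t)=\langle\dot W,\tfrac1{2c}\chi_{(x,t,c)}\rangle$ is the solution of the one-dimensional stochastic wave equation with propagation speed $c$. Let $B=(\underline b,\overline b)$ be an open interval and put $\underline r=1/\overline c$, $\overline r=1/\underline c$, $g(y)=\frac1{\sqrt{2\pi\underline r}}e^{-y^2/(2\underline r)}$. Then the upper probability $\overline P(B)=P(X\cap B\ne\emptyset)$ is given by $$\overline P(B)=\int_{-\infty}^{\frac2t\underline b}F_{\tau(\frac2t\underline b-y)}(\overline r-\underline r)\,g(y)\,dy+\int_{\frac2t\underline b}^{\frac2t\overline b}g(y)\,dy+\int_{\frac2t\overline b}^{\infty}F_{\tau(\frac2t\overline b-y)}(\overline r-\underline r)\,g(y)\,dy,$$ where, for $a\in\mathbb R$ and $s>0$, $F_{\tau(a)}(s)=P(\tau(a)\le s)=\frac{2}{\sqrt{2\pi s}}\int_{|a|}^\infty e^{-\frac{u^2}{2s}}du$ is the distribution function of the first hitting time $\tau(a)=\min\{s:w_s=a\}$ of a standard Brownian motion $(w_s)_{s\ge0}$ starting at $0$.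
   Context: White noise: here $d=1$, $D=\mathbb R\times[0,\infty)$, and $\mathcal S(D)$ is the space of restrictions to $D$ of Schwartz functions on $\mathbb R^2$. The white noise probability space $(\Omega,\Sigma,P)$ is the completion of $\mathcal S'(D)$ with the weak-$\ast$ Borel $\sigma$-algebra and the unique probability measure satisfying $\int e^{i\langle\omega,\varphi\rangle}dP(\omega)=e^{-\frac12\|\varphi\|^2_{L^2(D)}}$ for all $\varphi\in\mathcal S(D)$. White noise is $\langle\dot W(\omega),\varphi\rangle=\langle\omega,\varphi|_D\rangle$; it is Gaussian with $\mathrm E\langle\dot W,\varphi\rangle=0$ and $\mathrm E(\langle\dot W,\varphi\rangle)^2=\|\varphi\|_{L^2(D)}^2$ (Itô isometry), and by this isometry $\langle\dot W,\cdot\rangle$ is extended to functions in $L^2(\mathbb R^2)$. For $(x,t)\in\mathbb R\times(0,\infty)$ and $c>0$, $\chi_{(x,t,c)}$ is the indicator function of the backward triangle with vertex $(x,t)$, i.e. the region $0\le s\le t$, $|y-x|\le c(t-s)$ in the $(y,s)$-plane. The random field solution of $(\partial_t^2-c^2\partial_x^2)u_c=\dot W$ with support in $\mathbb R\times[0,\infty)$ is $u_c(x,t)=\langle\dot W,\tfrac1{2c}\chi_{(x,t,c)}\rangle$. A version of $u_c(x,t)$ is used for which $c\mapsto u_c(x,t,\omega)$ is continuous on $(0,\infty)$ for almost all $\omega$. *)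

theory Defs
  imports "HOL-Probability.Probability"
begin

definition partial_deriv :: "'a::euclidean_space \<Rightarrow> ('a \<Rightarrow> real) \<Rightarrow> 'a \<Rightarrow> real" where
  "partial_deriv e f p = frechet_derivative f (at p) e"

definition iter_partial :: "'a::euclidean_space list \<Rightarrow> ('a \<Rightarrow> real) \<Rightarrow> 'a \<Rightarrow> real" where
  "iter_partial es f = foldr partial_deriv es f"

text \<open>
  Multi-indices are encoded as lists of basis vectors. A function all of whose iterated partial
  derivatives (including the function itself, for the empty list) are differentiable everywhere
  is exactly a smooth function. Functions are real-valued, as required for the characteristic
  functional of a real Gaussian field.
\<close>

definition schwartz :: "('a::euclidean_space \<Rightarrow> real) set" where
  "schwartz = {f. \<forall>es \<in> lists Basis.
      iter_partial es f differentiable_on UNIV \<and>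
      (\<forall>k::nat. bounded (range (\<lambda>p. (1 + norm p) ^ k * iter_partial es f p)))}"

definition schwartz_seminorm :: "'a::euclidean_space list \<Rightarrow> nat \<Rightarrow> ('a \<Rightarrow> real) \<Rightarrow> real" where
  "schwartz_seminorm es k f = (SUP p. (1 + norm p) ^ k * \<bar>iter_partial es f p\<bar>)"

definition schwartz_topology :: "('a::euclidean_space \<Rightarrow> real) topology" where
  "schwartz_topology = topology_generated_by
     {{\<psi> \<in> schwartz. schwartz_seminorm es k (\<lambda>p. \<psi> p - \<phi> p) < \<epsilon>} | es k \<phi> \<epsilon>.
        es \<in> lists Basis \<and> \<phi> \<in> schwartz \<and> \<epsilon> > 0}"

text \<open>Points are pairs (space, time).\<close>

definition D :: "(real \<times> real) set" where
  "D = UNIV \<times> {0..}"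

text \<open>
  A function on \<open>D\<close> is represented by its extension by zero, so that the vector space operations
  are the pointwise ones.
\<close>

definition restrict_D :: "(real \<times> real \<Rightarrow> real) \<Rightarrow> real \<times> real \<Rightarrow> real" where
  "restrict_D \<phi> = (\<lambda>p. if p \<in> D then \<phi> p else 0)"

definition schwartz_D :: "(real \<times> real \<Rightarrow> real) set" where
  "schwartz_D = restrict_D ` schwartz"

text \<open>The quotient topology induced by the restriction map.\<close>

definition schwartz_D_topology :: "(real \<times> real \<Rightarrow> real) topology" where
  "schwartz_D_topology = topology (\<lambda>U. U \<subseteq> schwartz_D \<and>
     openin schwartz_topology {\<phi> \<in> schwartz. restrict_D \<phi> \<in> U})"

lemma openin_schwartz_D_topology:
  "openin schwartz_D_topology U \<longleftrightarrow>
     U \<subseteq> schwartz_D \<and> openin schwartz_topology {\<phi> \<in> schwartz. restrict_D \<phi> \<in> U}"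
proof -
  have "istopology (\<lambda>U. U \<subseteq> schwartz_D \<and>
          openin schwartz_topology {\<phi> \<in> schwartz. restrict_D \<phi> \<in> U})"
    unfolding istopology_def
  proof (intro conjI allI impI)
    fix S T :: "(real \<times> real \<Rightarrow> real) set"
    assume S: "S \<subseteq> schwartz_D \<and> openin schwartz_topology {\<phi> \<in> schwartz. restrict_D \<phi> \<in> S}"
      and T: "T \<subseteq> schwartz_D \<and> openin schwartz_topology {\<phi> \<in> schwartz. restrict_D \<phi> \<in> T}"
    show "S \<inter> T \<subseteq> schwartz_D" using S by blast
    have "{\<phi> \<in> schwartz. restrict_D \<phi> \<in> S \<inter> T} =
        {\<phi> \<in> schwartz. restrict_D \<phi> \<in> S} \<inter> {\<phi> \<in> schwartz. restrict_D \<phi> \<in> T}" by blast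
    then show "openin schwartz_topology {\<phi> \<in> schwartz. restrict_D \<phi> \<in> S \<inter> T}"
      using S T by auto
  next
    fix K :: "(real \<times> real \<Rightarrow> real) set set"
    assume K: "\<forall>S\<in>K. S \<subseteq> schwartz_D \<and>
                 openin schwartz_topology {\<phi> \<in> schwartz. restrict_D \<phi> \<in> S}"
    show "\<Union> K \<subseteq> schwartz_D" using K by blast
    have "{\<phi> \<in> schwartz. restrict_D \<phi> \<in> \<Union> K} =
        (\<Union>S\<in>K. {\<phi> \<in> schwartz. restrict_D \<phi> \<in> S})" by blast
    then show "openin schwartz_topology {\<phi> \<in> schwartz. restrict_D \<phi> \<in> \<Union> K}"
      using K by auto
  qed
  then show ?thesis
    unfolding schwartz_D_topology_def by (simp add: topology_inverse')
qed

type_synonym distribution = "(real \<times> real \<Rightarrow> real) \<Rightarrow> real"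

text \<open>The topological dual; elements are extensional, i.e. determined by their values on
  \<open>schwartz_D\<close>.\<close>

definition dual_D :: "distribution set" where
  "dual_D = {\<omega> \<in> extensional schwartz_D.
     (\<forall>\<phi> \<in> schwartz_D. \<forall>\<psi> \<in> schwartz_D. \<forall>a b.
        \<omega> (\<lambda>p. a * \<phi> p + b * \<psi> p) = a * \<omega> \<phi> + b * \<omega> \<psi>) \<and>
     continuous_map schwartz_D_topology euclideanreal \<omega>}"

text \<open>The weak-* topology is the topology of pointwise convergence on \<open>schwartz_D\<close>.\<close>

definition weak_star_topology :: "distribution topology" where
  "weak_star_topology = subtopology (product_topology (\<lambda>_. euclideanreal) schwartz_D) dual_D"

definition weak_star_borel :: "distribution measure" where
  "weak_star_borel = sigma dual_D {U. openin weak_star_topology U}"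

text \<open>The white noise probability space is \<open>completion P\<close> for \<open>P\<close> with this property.\<close>

definition white_noise_measure :: "distribution measure \<Rightarrow> bool" where
  "white_noise_measure P \<longleftrightarrow> prob_space P \<and> sets P = sets weak_star_borel \<and>
     (\<forall>\<phi> \<in> schwartz_D. (CLINT \<omega>|P. iexp (\<omega> \<phi>)) =
        of_real (exp (- (1/2) * (LINT p:D|lborel. (\<phi> p)\<^sup>2))))"

definition white_noise :: "distribution \<Rightarrow> (real \<times> real \<Rightarrow> real) \<Rightarrow> real" where
  "white_noise \<omega> \<phi> = \<omega> (restrict_D \<phi>)"

definition square_integrable :: "'a measure \<Rightarrow> ('a \<Rightarrow> real) \<Rightarrow> bool" where
  "square_integrable M f \<longleftrightarrow> f \<in> borel_measurable M \<and> integrable M (\<lambda>x. (f x)\<^sup>2)"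

text \<open>
  \<open>Y\<close> is a representative (a version) of the value at \<open>f\<close> of the extension of white noise to
  square integrable functions: it is the mean square limit of the values at Schwartz functions
  approximating \<open>f\<close> in \<open>L\<^sup>2(D)\<close>. By the Ito isometry the limit is, up to null sets,
  independent of the approximating sequence.
\<close>

definition white_noise_pairing ::
  "distribution measure \<Rightarrow> (real \<times> real \<Rightarrow> real) \<Rightarrow> (distribution \<Rightarrow> real) \<Rightarrow> bool" where
  "white_noise_pairing P f Y \<longleftrightarrow>
     square_integrable lborel f \<and> square_integrable (completion P) Y \<and>
     (\<exists>\<phi> :: nat \<Rightarrow> real \<times> real \<Rightarrow> real. (\<forall>n. \<phi> n \<in> schwartz) \<and>
        (\<lambda>n. \<integral>\<^sup>+p\<in>D. ennreal ((\<phi> n p - f p)\<^sup>2) \<partial>lborel) \<longlonglongrightarrow> 0 \<and>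
        (\<lambda>n. \<integral>\<^sup>+\<omega>. ennreal ((white_noise \<omega> (\<phi> n) - Y \<omega>)\<^sup>2) \<partial>completion P) \<longlonglongrightarrow> 0)"

definition backward_triangle :: "real \<Rightarrow> real \<Rightarrow> real \<Rightarrow> (real \<times> real) set" where
  "backward_triangle x t c = {(y, s). 0 \<le> s \<and> s \<le> t \<and> \<bar>y - x\<bar> \<le> c * (t - s)}"

definition wave_solution_at ::
  "distribution measure \<Rightarrow> real \<Rightarrow> real \<Rightarrow> real \<Rightarrow> (distribution \<Rightarrow> real) \<Rightarrow> bool" where
  "wave_solution_at P c x t Y \<longleftrightarrow>
     white_noise_pairing P (\<lambda>p. 1 / (2 * c) * indicator (backward_triangle x t c) p) Y"

definition upper_probability :: "'w measure \<Rightarrow> ('w \<Rightarrow> real set) \<Rightarrow> real set \<Rightarrow> real" where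
  "upper_probability M X B = measure M {\<omega> \<in> space M. X \<omega> \<inter> B \<noteq> {}}"

definition brownian_motion :: "'w measure \<Rightarrow> (real \<Rightarrow> 'w \<Rightarrow> real) \<Rightarrow> bool" where
  "brownian_motion Q w \<longleftrightarrow> prob_space Q \<and>
     (\<forall>s\<ge>0. w s \<in> borel_measurable Q) \<and>
     (AE \<omega> in Q. w 0 \<omega> = 0) \<and>
     (\<forall>n (r :: nat \<Rightarrow> real). 0 \<le> r 0 \<and> strict_mono_on {..n} r \<longrightarrow>
        prob_space.indep_vars Q (\<lambda>_. borel) (\<lambda>i \<omega>. w (r (Suc i)) \<omega> - w (r i) \<omega>) {..<n}) \<and>
     (\<forall>s r. 0 \<le> s \<and> s < r \<longrightarrow>
        distributed Q lborel (\<lambda>\<omega>. w r \<omega> - w s \<omega>) (normal_density 0 (sqrt (r - s)))) \<and>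
     (AE \<omega> in Q. continuous_on {0..} (\<lambda>s. w s \<omega>))"

text \<open>The value is \<open>\<infinity>\<close> if the level is never hit; on continuous paths the infimum is attained.\<close>

definition hitting_time :: "(real \<Rightarrow> 'w \<Rightarrow> real) \<Rightarrow> real \<Rightarrow> 'w \<Rightarrow> ereal" where
  "hitting_time w a \<omega> = Inf {ereal s | s. 0 \<le> s \<and> w s \<omega> = a}"

definition hitting_cdf :: "real \<Rightarrow> real \<Rightarrow> real" where
  "hitting_cdf a s =
     2 / sqrt (2 * pi * s) * (LINT u:{\<bar>a\<bar>..}|lborel. exp (- u\<^sup>2 / (2 * s)))"

end

theory Submission
  imports Defs
begin

text \<open>
  Reparametrise the propagation speed by \<open>r = 1 / c\<close> and rescale to \<open>W r = (2 / t) u\<^sub>1\<^sub>/\<^sub>r(x, t)\<close>. Backward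
  triangles with a common vertex are nested, and the one of speed \<open>c\<close> has area \<open>c t\<^sup>2\<close>, so by the Ito
  isometry the covariance of \<open>W r\<close> and \<open>W q\<close> is \<open>min r q\<close> (\<open>wave_kernel_product\<close>). White noise is
  Gaussian, hence \<open>W\<close> is a Brownian motion observed during \<open>[1 / c_hi, 1 / c_lo]\<close>
  (\<open>wave_solution_brownian_segment\<close>), and the upper probability is the probability that this motion
  visits \<open>(\<alpha>, \<beta>)\<close>, where \<open>\<alpha> = 2 b_lo / t\<close> and \<open>\<beta> = 2 b_hi / t\<close>. Condition on the starting value \<open>y\<close>,
  which has density \<open>g\<close>: a start inside \<open>(\<alpha>, \<beta>)\<close> is already a visit, and a continuous path starting at
  \<open>y \<le> \<alpha>\<close> visits the interval exactly if it exceeds \<open>\<alpha>\<close>. Up to null sets this means that the increment,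
  a Brownian motion independent of \<open>y\<close>, reaches the level \<open>\<alpha> - y\<close> within time \<open>1 / c_lo - 1 / c_hi\<close>.
  The case \<open>y \<ge> \<beta>\<close> is the mirror image (\<open>prob_visits_interval\<close>).

  Both assertions of the theorem thus rest on the reflection principle (\<open>reflection_principle\<close>). It is
  proved by reflecting random walks with symmetric steps after their first passage and by refining the
  grid, so that each step involves only finitely many independent increments.
  Independence of the increments of \<open>W\<close> comes from the characteristic functional: increments are
  \<open>L\<^sup>2\<close>-limits of white noise at Schwartz functions, so their joint characteristic function is known, it
  factorises because the increments are orthogonal, and a factorising characteristic function implies
  independence (\<open>indep_vars_of_char\<close>).
\<close>

section \<open>Independence from characteristic functions\<close>

lemma (in prob_space) char_distr:
  assumes [measurable]: "random_variable borel (X :: 'a \<Rightarrow> real)"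
  shows "char (distr M borel X) s = (CLINT \<omega>|M. iexp (s * X \<omega>))"
  unfolding char_def by (subst integral_distr) auto

text \<open>
  Under the density proportional to \<open>2 + F\<close> the characteristic function of \<open>X\<close> is the same as under
  the original measure, so by Levy's uniqueness theorem the law of \<open>X\<close> is the same. The summand 2 keeps
  the density positive whatever the sign of \<open>F\<close> and prevents the total mass from vanishing.
\<close>

lemma (in prob_space) expectation_indicator_of_char_real:
  fixes X F :: "'a \<Rightarrow> real"
  assumes X[measurable]: "random_variable borel X" and F[measurable]: "random_variable borel F"
    and bound: "\<And>\<omega>. \<bar>F \<omega>\<bar> \<le> 1"
    and char: "\<And>s. (CLINT \<omega>|M. F \<omega> * iexp (s * X \<omega>)) = expectation F * char (distr M borel X) s"
    and A[measurable]: "A \<in> sets borel"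
  shows "expectation (\<lambda>\<omega>. F \<omega> * indicator A (X \<omega>)) = expectation F * prob (X -` A \<inter> space M)"
proof -
  define c where "c = expectation (\<lambda>\<omega>. 2 + F \<omega>)"
  have intF: "integrable M F"
    by (rule integrable_const_bound[where B=1]) (use bound in auto)
  have c_eq: "c = 2 + expectation F"
    unfolding c_def using intF by (simp add: prob_space)
  have low: "1 \<le> 2 + F \<omega>" for \<omega> using bound[of \<omega>] by linarith
  have "expectation (\<lambda>\<omega>. 1) \<le> c" unfolding c_def
    by (rule integral_mono) (use intF low in auto)
  then have c1: "1 \<le> c" by (simp add: prob_space)
  define G where "G = (\<lambda>\<omega>. (2 + F \<omega>) / c)"
  have G0: "0 \<le> G \<omega>" for \<omega> using low[of \<omega>] c1 by (simp add: G_def)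
  have G[measurable]: "G \<in> borel_measurable M" unfolding G_def by simp
  define N where "N = density M (\<lambda>\<omega>. ennreal (G \<omega>))"
  have intG: "integrable M G" unfolding G_def using intF by simp
  have "(\<integral>\<^sup>+ \<omega>. ennreal (G \<omega>) \<partial>M) = ennreal (expectation G)"
    by (rule nn_integral_eq_integral) (use intG G0 in auto)
  also have "expectation G = 1" using c1 intF unfolding G_def by (simp add: c_def)
  finally have N1: "emeasure N (space N) = 1"
    unfolding N_def by (subst emeasure_density) (auto simp: cong: nn_integral_cong)
  interpret N: prob_space N by (rule prob_spaceI[OF N1])
  have XN[measurable]: "X \<in> borel_measurable N" by (simp add: N_def)
  have "distr N borel X = distr M borel X"
  proof (rule Levy_uniqueness)
    show "real_distribution (distr N borel X)" "real_distribution (distr M borel X)"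
      by (auto intro!: real_distribution_distr N.real_distribution_distr)
    show "char (distr N borel X) = char (distr M borel X)"
    proof
      fix s
      have i0: "complex_integrable M (\<lambda>\<omega>. iexp (s * X \<omega>))"
        by (rule integrable_iexp) auto
      have i1: "complex_integrable M (\<lambda>\<omega>. F \<omega> * iexp (s * X \<omega>))"
        by (rule integrable_const_bound[where B=1]) (use bound in \<open>auto simp: norm_mult\<close>)
      have "char (distr N borel X) s = (CLINT \<omega>|N. iexp (s * X \<omega>))"
        by (rule N.char_distr) simp
      also have "\<dots> = (CLINT \<omega>|M. G \<omega> *\<^sub>R iexp (s * X \<omega>))"
        unfolding N_def by (subst integral_density) (use G0 in auto)
      also have "\<dots> = (CLINT \<omega>|M. (2 * iexp (s * X \<omega>) + F \<omega> * iexp (s * X \<omega>)) / c)"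
        by (rule Bochner_Integration.integral_cong)
           (auto simp: G_def scaleR_conv_of_real field_simps)
      also have "\<dots> = (2 * (CLINT \<omega>|M. iexp (s * X \<omega>)) + (CLINT \<omega>|M. F \<omega> * iexp (s * X \<omega>))) / c"
        using i0 i1 by simp
      also have "\<dots> = (2 + expectation F) * char (distr M borel X) s / c"
        unfolding char by (simp add: char_distr algebra_simps)
      also have "\<dots> = char (distr M borel X) s" using c1 c_eq
        by (metis (no_types, lifting) nonzero_mult_div_cancel_left of_real_add of_real_eq_0_iff
             of_real_numeral not_one_le_zero)
      finally show "char (distr N borel X) s = char (distr M borel X) s" .
    qed
  qed
  then have eq: "measure (distr N borel X) A = measure (distr M borel X) A" by simp
  have "measure (distr N borel X) A = (LINT \<omega>|N. indicator A (X \<omega>))"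
    by (subst integral_distr[symmetric, where N=borel]) auto
  also have "\<dots> = expectation (\<lambda>\<omega>. G \<omega> * indicator A (X \<omega>))"
    unfolding N_def by (subst integral_density) (use G0 in auto)
  also have "\<dots> = expectation (\<lambda>\<omega>. (2 * indicator A (X \<omega>) + F \<omega> * indicator A (X \<omega>)) / c)"
    by (rule Bochner_Integration.integral_cong) (auto simp: G_def field_simps)
  also have "\<dots> = (2 * expectation (\<lambda>\<omega>. indicator A (X \<omega>)) + expectation (\<lambda>\<omega>. F \<omega> * indicator A (X \<omega>))) / c"
  proof -
    have "integrable M (\<lambda>\<omega>. indicator A (X \<omega>) :: real)"
      by (rule integrable_const_bound[where B=1]) (auto simp: indicator_def)
    moreover have "integrable M (\<lambda>\<omega>. F \<omega> * indicator A (X \<omega>))"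
      by (rule integrable_const_bound[where B=1]) (use bound in \<open>auto simp: indicator_def\<close>)
    ultimately show ?thesis by simp
  qed
  also have "expectation (\<lambda>\<omega>. indicator A (X \<omega>)) = measure (distr M borel X) A"
    by (subst integral_distr[symmetric, where N=borel]) auto
  finally have "expectation (\<lambda>\<omega>. F \<omega> * indicator A (X \<omega>)) = expectation F * measure (distr M borel X) A"
    using c1 c_eq unfolding eq by (auto simp: field_simps)
  then show ?thesis by (simp add: measure_distr)
qed

text \<open>
  The conjugate of \<open>F\<close> satisfies the same hypothesis (replace \<open>s\<close> by \<open>- s\<close>), hence so do the real and
  the imaginary part.
\<close>

lemma (in prob_space) expectation_indicator_of_char:
  fixes X :: "'a \<Rightarrow> real" and F :: "'a \<Rightarrow> complex"
  assumes X[measurable]: "random_variable borel X" and F[measurable]: "random_variable borel F"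
    and bound: "\<And>\<omega>. norm (F \<omega>) \<le> 1"
    and char: "\<And>s. (CLINT \<omega>|M. F \<omega> * iexp (s * X \<omega>)) = (CLINT \<omega>|M. F \<omega>) * char (distr M borel X) s"
    and A[measurable]: "A \<in> sets borel"
  shows "(CLINT \<omega>|M. F \<omega> * indicator A (X \<omega>)) = (CLINT \<omega>|M. F \<omega>) * prob (X -` A \<inter> space M)"
proof -
  have intF: "complex_integrable M F"
    by (rule integrable_const_bound[where B=1]) (use bound in auto)
  have intFA: "complex_integrable M (\<lambda>\<omega>. F \<omega> * indicator A (X \<omega>))"
    by (rule integrable_const_bound[where B=1]) (use bound in \<open>auto simp: norm_mult indicator_def\<close>)
  have [measurable]: "(\<lambda>\<omega>. cnj (F \<omega>)) \<in> borel_measurable M"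
    by (rule borel_measurable_continuous_on[OF _ F]) (intro continuous_intros)
  have int: "complex_integrable M (\<lambda>\<omega>. F \<omega> * iexp (s * X \<omega>))"
    "complex_integrable M (\<lambda>\<omega>. cnj (F \<omega>) * iexp (s * X \<omega>))" for s
    by (rule integrable_const_bound[where B=1]; use bound in \<open>auto simp: norm_mult\<close>)+
  have cnj: "(CLINT \<omega>|M. cnj (F \<omega>) * iexp (s * X \<omega>)) = cnj (CLINT \<omega>|M. F \<omega>) * char (distr M borel X) s" for s
  proof -
    have "(CLINT \<omega>|M. cnj (F \<omega>) * iexp (s * X \<omega>)) = (CLINT \<omega>|M. cnj (F \<omega> * iexp ((-s) * X \<omega>)))"
      by (rule Bochner_Integration.integral_cong) (auto simp: exp_cnj)
    also have "\<dots> = cnj (CLINT \<omega>|M. F \<omega> * iexp ((-s) * X \<omega>))"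
      by (rule Bochner_Integration.integral_cnj)
    also have "\<dots> = cnj (CLINT \<omega>|M. F \<omega>) * cnj (char (distr M borel X) (-s))"
      unfolding char by (rule complex_cnj_mult)
    also have "cnj (char (distr M borel X) (-s)) = char (distr M borel X) s"
      by (simp add: char_distr exp_cnj flip: Bochner_Integration.integral_cnj)
    finally show ?thesis .
  qed
  have re: "(CLINT \<omega>|M. Re (F \<omega>) * iexp (s * X \<omega>)) = expectation (\<lambda>\<omega>. Re (F \<omega>)) * char (distr M borel X) s" for s
  proof -
    have "(CLINT \<omega>|M. Re (F \<omega>) * iexp (s * X \<omega>)) = (CLINT \<omega>|M. (F \<omega> * iexp (s * X \<omega>) + cnj (F \<omega>) * iexp (s * X \<omega>)) / 2)"
      by (rule Bochner_Integration.integral_cong) (auto simp flip: distrib_right simp: complex_add_cnj)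
    also have "\<dots> = ((CLINT \<omega>|M. F \<omega>) + cnj (CLINT \<omega>|M. F \<omega>)) / 2 * char (distr M borel X) s"
      using int char cnj by (simp add: algebra_simps add_divide_distrib)
    finally show ?thesis using intF by (simp add: complex_add_cnj)
  qed
  have im: "(CLINT \<omega>|M. Im (F \<omega>) * iexp (s * X \<omega>)) = expectation (\<lambda>\<omega>. Im (F \<omega>)) * char (distr M borel X) s" for s
  proof -
    have "(CLINT \<omega>|M. Im (F \<omega>) * iexp (s * X \<omega>)) = (CLINT \<omega>|M. (F \<omega> * iexp (s * X \<omega>) - cnj (F \<omega>) * iexp (s * X \<omega>)) / (2 * \<i>))"
    proof (rule Bochner_Integration.integral_cong)
      have "complex_of_real (Im z) = (z - cnj z) / (2 * \<i>)" for z
        by (simp add: complex_eq_iff)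
      then show "Im (F \<omega>) * iexp (s * X \<omega>) = (F \<omega> * iexp (s * X \<omega>) - cnj (F \<omega>) * iexp (s * X \<omega>)) / (2 * \<i>)" for \<omega>
        by (simp only: left_diff_distrib diff_divide_distrib times_divide_eq_left)
    qed simp
    also have "\<dots> = ((CLINT \<omega>|M. F \<omega>) - cnj (CLINT \<omega>|M. F \<omega>)) / (2 * \<i>) * char (distr M borel X) s"
      using int char cnj by (simp add: algebra_simps diff_divide_distrib)
    also have "((CLINT \<omega>|M. F \<omega>) - cnj (CLINT \<omega>|M. F \<omega>)) / (2 * \<i>) = Im (CLINT \<omega>|M. F \<omega>)"
      by (simp add: complex_eq_iff)
    finally show ?thesis unfolding integral_Im[OF intF] .
  qed
  have bRe: "\<bar>Re (F \<omega>)\<bar> \<le> 1" and bIm: "\<bar>Im (F \<omega>)\<bar> \<le> 1" for \<omega>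
    using bound[of \<omega>] abs_Re_le_cmod[of "F \<omega>"] abs_Im_le_cmod[of "F \<omega>"] by linarith+
  have "expectation (\<lambda>\<omega>. Re (F \<omega>) * indicator A (X \<omega>)) = expectation (\<lambda>\<omega>. Re (F \<omega>)) * prob (X -` A \<inter> space M)"
    by (rule expectation_indicator_of_char_real[OF _ _ bRe re]) auto
  moreover have "expectation (\<lambda>\<omega>. Im (F \<omega>) * indicator A (X \<omega>)) = expectation (\<lambda>\<omega>. Im (F \<omega>)) * prob (X -` A \<inter> space M)"
    by (rule expectation_indicator_of_char_real[OF _ _ bIm im]) auto
  moreover have "Re (z * indicator A r) = Re z * indicator A r" "Im (z * indicator A r) = Im z * indicator A r"
    for z :: complex and r by (auto simp: indicator_def)
  then have "Re (CLINT \<omega>|M. F \<omega> * indicator A (X \<omega>)) = expectation (\<lambda>\<omega>. Re (F \<omega>) * indicator A (X \<omega>))"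
    "Im (CLINT \<omega>|M. F \<omega> * indicator A (X \<omega>)) = expectation (\<lambda>\<omega>. Im (F \<omega>) * indicator A (X \<omega>))"
    using integral_Re[OF intFA] integral_Im[OF intFA] by simp_all
  ultimately show ?thesis
    using integral_Re[OF intF] integral_Im[OF intF] by (simp add: complex_eq_iff)
qed

text \<open>
  Kac's theorem, reduced to uniqueness in dimension one: the factors \<open>iexp (t i * X i)\<close> are exchanged
  for indicators one index at a time, and at each exchange the product of all other factors acts as the
  bounded complex weight \<open>F\<close> of the preceding lemma.
\<close>

lemma (in prob_space) indep_vars_of_char:
  fixes X :: "'i \<Rightarrow> 'a \<Rightarrow> real"
  assumes I: "finite I" "I \<noteq> {}"
    and X[measurable]: "\<And>i. i \<in> I \<Longrightarrow> random_variable borel (X i)"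
    and char: "\<And>t. (CLINT \<omega>|M. iexp (\<Sum>i\<in>I. t i * X i \<omega>)) = (\<Prod>i\<in>I. char (distr M borel (X i)) (t i))"
  shows "indep_vars (\<lambda>_. borel) X I"
proof -
  have main: "\<And>t. (CLINT \<omega>|M. (\<Prod>i\<in>J. indicator (A i) (X i \<omega>)) * iexp (\<Sum>i\<in>I-J. t i * X i \<omega>)) =
     (\<Prod>i\<in>J. complex_of_real (prob (X i -` A i \<inter> space M))) * (\<Prod>i\<in>I-J. char (distr M borel (X i)) (t i))"
    if J: "J \<subseteq> I" and A: "\<And>i. i \<in> I \<Longrightarrow> A i \<in> sets borel" for J A
    using finite_subset[OF J I(1)] J
  proof (induction J rule: finite_induct)
    case empty
    then show ?case using char by simp
  next
    case (insert k J)
    let ?p = "\<lambda>i. complex_of_real (prob (X i -` A i \<inter> space M))"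
    let ?K = "I - insert k J"
    have IJ: "I - J = insert k ?K" "k \<notin> ?K" "finite ?K" and k: "k \<in> I" and JI: "J \<subseteq> I"
      using insert I by auto
    define F where "F = (\<lambda>\<omega>. (\<Prod>i\<in>J. indicator (A i) (X i \<omega>)) * iexp (\<Sum>i\<in>?K. t i * X i \<omega>))"
    have [measurable]: "X k \<in> borel_measurable M" using k by simp
    have [measurable]: "F \<in> borel_measurable M"
    proof -
      have "(\<lambda>\<omega>. indicator (A i) (X i \<omega>) :: complex) \<in> borel_measurable M" if "i \<in> J" for i
        using that JI A X by (intro measurable_compose[OF X borel_measurable_indicator]) auto
      moreover have "(\<lambda>\<omega>. \<Sum>i\<in>?K. t i * X i \<omega>) \<in> borel_measurable M"
        by (intro borel_measurable_sum borel_measurable_times borel_measurable_const X) auto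
      then have "(\<lambda>\<omega>. iexp (\<Sum>i\<in>?K. t i * X i \<omega>)) \<in> borel_measurable M"
        by (rule measurable_compose) measurable
      ultimately show ?thesis
        unfolding F_def by (intro borel_measurable_times borel_measurable_prod)
    qed
    have bound: "norm (F \<omega>) \<le> 1" for \<omega>
      unfolding F_def by (auto simp: norm_mult prod_norm[symmetric] indicator_def intro!: prod_le_1)
    let ?c = "(\<Prod>i\<in>J. ?p i) * (\<Prod>i\<in>?K. char (distr M borel (X i)) (t i))"
    have Fs: "(CLINT \<omega>|M. F \<omega> * iexp (s * X k \<omega>)) = ?c * char (distr M borel (X k)) s" for s
    proof -
      have sum: "(\<Sum>i\<in>?K. (t(k := s)) i * X i \<omega>) = (\<Sum>i\<in>?K. t i * X i \<omega>)" for \<omega>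
        by (rule sum.cong) auto
      have prod: "(\<Prod>i\<in>?K. char (distr M borel (X i)) ((t(k := s)) i)) = (\<Prod>i\<in>?K. char (distr M borel (X i)) (t i))"
        by (rule prod.cong) auto
      have "F \<omega> * iexp (s * X k \<omega>) = (\<Prod>i\<in>J. indicator (A i) (X i \<omega>)) * iexp (\<Sum>i\<in>I-J. (t(k := s)) i * X i \<omega>)" for \<omega>
        unfolding F_def IJ(1) using IJ(2,3) by (simp del: fun_upd_apply add: sum exp_add[symmetric] distrib_left mult.assoc) (simp add: algebra_simps)
      then have "(CLINT \<omega>|M. F \<omega> * iexp (s * X k \<omega>)) = (\<Prod>i\<in>J. ?p i) * (\<Prod>i\<in>I-J. char (distr M borel (X i)) ((t(k := s)) i))"
        by (simp only: insert.IH[OF JI])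
      also have "\<dots> = ?c * char (distr M borel (X k)) s"
        unfolding IJ(1) using IJ(2,3) by (simp del: fun_upd_apply add: prod) simp
      finally show ?thesis .
    qed
    interpret Xk: real_distribution "distr M borel (X k)" by (rule real_distribution_distr) simp
    have c: "(CLINT \<omega>|M. F \<omega>) = ?c" using Fs[of 0] by (simp add: Xk.char_zero)
    have "(CLINT \<omega>|M. F \<omega> * indicator (A k) (X k \<omega>)) = (CLINT \<omega>|M. F \<omega>) * ?p k"
      by (rule expectation_indicator_of_char[OF _ _ bound]) (use A k Fs c in auto)
    moreover have "F \<omega> * indicator (A k) (X k \<omega>) = (\<Prod>i\<in>insert k J. indicator (A i) (X i \<omega>)) * iexp (\<Sum>i\<in>?K. t i * X i \<omega>)" for \<omega>
      unfolding F_def using insert.hyps by (simp add: mult_ac)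
    ultimately show ?case unfolding c using insert.hyps by (simp add: mult_ac)
  qed
  show ?thesis
  proof (subst indep_vars_finite[where E="\<lambda>_. sets borel"])
    show "\<forall>A\<in>I \<rightarrow> sets borel. prob (\<Inter>j\<in>I. X j -` A j \<inter> space M) = (\<Prod>j\<in>I. prob (X j -` A j \<inter> space M))"
    proof
      fix A assume "A \<in> I \<rightarrow> sets (borel :: real measure)"
      then have A: "\<And>i. i \<in> I \<Longrightarrow> A i \<in> sets borel" by auto
      let ?E = "\<Inter>j\<in>I. X j -` A j \<inter> space M"
      have E: "?E \<in> events" using I A by (intro sets.finite_INT) auto
      have "(\<Prod>i\<in>I. indicator (A i) (X i \<omega>)) = complex_of_real (indicator ?E \<omega>)" if that': "\<omega> \<in> space M" for \<omega>
      proof (cases "\<omega> \<in> ?E")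
        case True
        then have "\<omega> \<in> X i -` A i" if "i \<in> I" for i using that by blast
        with True show ?thesis by (subst prod.neutral) auto
      next
        case False
        then obtain i where "i \<in> I" "X i \<omega> \<notin> A i" using that' I(2) by blast
        then have "indicator (A i) (X i \<omega>) = (0 :: complex)" by simp
        with \<open>i \<in> I\<close> have "(\<Prod>i\<in>I. indicator (A i) (X i \<omega>)) = (0 :: complex)"
          using I(1) by (intro prod_zero bexI[of _ i])
        then show ?thesis using False by simp
      qed
      then have "(CLINT \<omega>|M. (\<Prod>i\<in>I. indicator (A i) (X i \<omega>))) = (CLINT \<omega>|M. complex_of_real (indicator ?E \<omega>))"
        by (intro Bochner_Integration.integral_cong) auto
      also have "\<dots> = prob ?E" using E by (subst integral_complex_of_real) simp
      finally have "complex_of_real (prob ?E) = (\<Prod>i\<in>I. complex_of_real (prob (X i -` A i \<inter> space M)))"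
        using main[OF order_refl A] by simp
      then show "prob ?E = (\<Prod>j\<in>I. prob (X j -` A j \<inter> space M))"
        by (simp only: of_real_prod[symmetric] of_real_eq_iff)
    qed
  qed (use I X in \<open>auto simp: Int_stable_def sets.sigma_sets_eq[of borel, simplified]\<close>)
qed

section \<open>The reflection principle\<close>

lemma (in prob_space) prob_tendsto_AE:
  assumes E: "\<And>n. E n \<in> events" "F \<in> events"
    and ae: "AE \<omega> in M. \<forall>\<^sub>F n in sequentially. \<omega> \<in> E n \<longleftrightarrow> \<omega> \<in> F"
  shows "(\<lambda>n. prob (E n)) \<longlonglongrightarrow> prob F"
proof -
  have "(\<lambda>n. expectation (indicator (E n) :: 'a \<Rightarrow> real)) \<longlonglongrightarrow> expectation (indicator F)"
  proof (rule integral_dominated_convergence[where w="\<lambda>_. 1"])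
    show "AE \<omega> in M. (\<lambda>n. indicator (E n) \<omega>) \<longlonglongrightarrow> (indicator F \<omega> :: real)"
      using ae
    proof eventually_elim
      case (elim \<omega>)
      then show ?case
        by (intro tendsto_eventually) (auto elim!: eventually_mono simp: indicator_def)
    qed
  qed (use E in auto)
  then show ?thesis using E by simp
qed

text \<open>
  A joint law of independent variables is the product of its marginals, and those do not notice the
  change of sign.
\<close>

lemma (in prob_space) indep_symmetric_flip:
  fixes X :: "'i \<Rightarrow> 'a \<Rightarrow> real"
  assumes indep: "indep_vars (\<lambda>_. borel) X I" and I: "I \<noteq> {}"
    and sym: "\<And>i. i \<in> J \<Longrightarrow> distr M borel (\<lambda>\<omega>. - X i \<omega>) = distr M borel (X i)"
    and Q: "{v \<in> space (\<Pi>\<^sub>M i\<in>I. borel). Q v} \<in> sets (\<Pi>\<^sub>M i\<in>I. borel)"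
  shows "prob {\<omega>\<in>space M. Q (\<lambda>i\<in>I. if i \<in> J then - X i \<omega> else X i \<omega>)} = prob {\<omega>\<in>space M. Q (\<lambda>i\<in>I. X i \<omega>)}"
proof -
  define Y where "Y = (\<lambda>i \<omega>. if i \<in> J then - X i \<omega> else X i \<omega>)"
  have X: "\<And>i. i \<in> I \<Longrightarrow> random_variable borel (X i)"
    using indep by (auto simp: indep_vars_def)
  have Y: "indep_vars (\<lambda>_. borel) Y I"
  proof -
    have "indep_vars (\<lambda>_. borel) (\<lambda>i \<omega>. (\<lambda>x. if i \<in> J then - x else x) (X i \<omega>)) I"
      by (rule indep_vars_compose2[OF indep]) auto
    then show ?thesis by (simp add: Y_def)
  qed
  have Yrv: "\<And>i. i \<in> I \<Longrightarrow> random_variable borel (Y i)"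
    using Y by (auto simp: indep_vars_def)
  let ?X = "\<lambda>\<omega>. \<lambda>i\<in>I. X i \<omega>" and ?Y = "\<lambda>\<omega>. \<lambda>i\<in>I. Y i \<omega>"
  let ?P = "\<Pi>\<^sub>M i\<in>I. (borel :: real measure)"
  have "distr M ?P ?Y = (\<Pi>\<^sub>M i\<in>I. distr M borel (Y i))"
    using indep_vars_iff_distr_eq_PiM'[OF I Yrv] Y by simp
  also have "\<dots> = (\<Pi>\<^sub>M i\<in>I. distr M borel (X i))"
  proof (rule PiM_cong)
    show "distr M borel (Y i) = distr M borel (X i)" for i
      using sym by (cases "i \<in> J") (simp_all add: Y_def)
  qed simp
  also have "\<dots> = distr M ?P ?X"
    using indep_vars_iff_distr_eq_PiM'[OF I X] indep by simp
  finally have eq: "distr M ?P ?Y = distr M ?P ?X" .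
  have mX: "?X \<in> M \<rightarrow>\<^sub>M ?P" and mY: "?Y \<in> M \<rightarrow>\<^sub>M ?P"
    by (auto intro!: measurable_restrict X Yrv)
  let ?S = "{v \<in> space ?P. Q v}"
  have "measure (distr M ?P ?Y) ?S = measure (distr M ?P ?X) ?S" by (simp add: eq)
  then have "prob (?Y -` ?S \<inter> space M) = prob (?X -` ?S \<inter> space M)"
    using Q by (simp add: measure_distr mX mY)
  moreover have "?Y -` ?S \<inter> space M = {\<omega>\<in>space M. Q (?Y \<omega>)}" "?X -` ?S \<inter> space M = {\<omega>\<in>space M. Q (?X \<omega>)}"
    using measurable_space[OF mX] measurable_space[OF mY] by auto
  ultimately show ?thesis by (simp add: Y_def)
qed

text \<open>
  Let \<open>k\<close> be the first index with \<open>S k > a\<close>, and flip the signs of all later steps. This preserves the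
  law and replaces the end point \<open>S n\<close> by \<open>2 * S k - S n\<close>. The reflected end point is at most \<open>a\<close> exactly
  if \<open>S n \<ge> 2 * S k - a\<close>. This implies \<open>S n > a\<close>, which gives the upper bound. Conversely, if all steps are
  at most \<open>e\<close>, then \<open>S k \<le> a + e\<close>, and the condition \<open>S n \<ge> 2 * S k - a\<close> is implied by
  \<open>S n > a + 2 * e\<close>, which gives the lower bound.
\<close>

lemma (in prob_space) reflection_discrete:
  fixes X :: "nat \<Rightarrow> 'a \<Rightarrow> real" and a :: real
  assumes indep: "indep_vars (\<lambda>_. borel) X {..n}"
    and sym: "\<And>i. i \<in> {1..n} \<Longrightarrow> distr M borel (\<lambda>\<omega>. - X i \<omega>) = distr M borel (X i)"
    and e: "e > 0"
  defines "S \<equiv> \<lambda>k \<omega>. \<Sum>i\<le>k. X i \<omega>"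
  shows "prob {\<omega>\<in>space M. S 0 \<omega> \<le> a \<and> (\<exists>k\<le>n. S k \<omega> > a)} \<le> 2 * prob {\<omega>\<in>space M. S 0 \<omega> \<le> a \<and> S n \<omega> > a}" (is ?upper)
    and "prob {\<omega>\<in>space M. S 0 \<omega> \<le> a \<and> S n \<omega> > a} + prob {\<omega>\<in>space M. S 0 \<omega> \<le> a \<and> S n \<omega> > a + 2 * e}
      \<le> prob {\<omega>\<in>space M. S 0 \<omega> \<le> a \<and> (\<exists>k\<le>n. S k \<omega> > a)} + prob {\<omega>\<in>space M. \<exists>k\<in>{1..n}. \<bar>X k \<omega>\<bar> > e}" (is ?lower)
proof -
  have X[measurable]: "random_variable borel (X i)" if "i \<le> n" for i
    using indep that by (auto simp: indep_vars_def)
  have S[measurable]: "random_variable borel (S k)" if "k \<le> n" for k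
    unfolding S_def using that by (intro borel_measurable_sum) auto
  define T where "T = (\<lambda>k \<omega>. (\<forall>j<k. S j \<omega> \<le> a) \<and> S k \<omega> > a)"
  let ?A = "{\<omega>\<in>space M. S 0 \<omega> \<le> a \<and> (\<exists>k\<le>n. S k \<omega> > a)}"
  let ?R = "\<lambda>k. {\<omega>\<in>space M. T k \<omega> \<and> 2 * S k \<omega> - S n \<omega> \<le> a}"
  have mT[measurable]: "{\<omega>\<in>space M. T k \<omega>} \<in> events" if "k \<le> n" for k
    unfolding T_def using that by (intro sets.sets_Collect_conj sets.sets_Collect_finite_All) auto
  have flip: "prob {\<omega>\<in>space M. T k \<omega> \<and> S n \<omega> \<le> a} = prob (?R k)" if k: "k \<in> {1..n}" for k
  proof -
    define s where "s = (\<lambda>j (v :: nat \<Rightarrow> real). \<Sum>i\<le>j. v i)"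
    define Q where "Q = (\<lambda>v. (\<forall>j<k. s j v \<le> a) \<and> s k v > a \<and> s n v \<le> a)"
    let ?P = "\<Pi>\<^sub>M i\<in>{..n}. (borel :: real measure)"
    have s: "s j \<in> borel_measurable ?P" if "j \<le> n" for j
      unfolding s_def using that by (intro borel_measurable_sum measurable_component_singleton) auto
    have Q: "{v \<in> space ?P. Q v} \<in> sets ?P"
      unfolding Q_def using k s
      by (intro sets.sets_Collect_conj sets.sets_Collect_finite_All borel_measurable_le borel_measurable_less) auto
    have sX: "s j (\<lambda>i\<in>{..n}. X i \<omega>) = S j \<omega>" if "j \<le> n" for j \<omega>
      unfolding s_def S_def using that by (intro sum.cong) auto
    let ?f = "\<lambda>\<omega>. \<lambda>i\<in>{..n}. if i \<in> {k<..n} then - X i \<omega> else X i \<omega>"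
    have sY: "s j (?f \<omega>) = S j \<omega>" if "j \<le> k" for j \<omega>
      unfolding s_def S_def using that k by (intro sum.cong) auto
    have sYn: "s n (?f \<omega>) = 2 * S k \<omega> - S n \<omega>" for \<omega>
    proof -
      have un: "{..n} = {..k} \<union> {k<..n}" using k by auto
      have "s n (?f \<omega>) = (\<Sum>i\<le>k. X i \<omega>) + (\<Sum>i\<in>{k<..n}. - X i \<omega>)"
        unfolding s_def un by (subst sum.union_disjoint) (use k in \<open>auto intro!: sum.cong\<close>)
      moreover have "S n \<omega> = S k \<omega> + (\<Sum>i\<in>{k<..n}. X i \<omega>)"
        unfolding S_def un by (subst sum.union_disjoint) auto
      ultimately show ?thesis by (simp add: S_def sum_negf)
    qed
    have "prob {\<omega>\<in>space M. Q (?f \<omega>)} = prob {\<omega>\<in>space M. Q (\<lambda>i\<in>{..n}. X i \<omega>)}"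
      by (rule indep_symmetric_flip[OF indep _ _ Q]) (use k sym in auto)
    moreover have "{\<omega>\<in>space M. Q (?f \<omega>)} = ?R k"
      unfolding Q_def T_def using sY sYn by auto
    moreover have "{\<omega>\<in>space M. Q (\<lambda>i\<in>{..n}. X i \<omega>)} = {\<omega>\<in>space M. T k \<omega> \<and> S n \<omega> \<le> a}"
      unfolding Q_def T_def using k by (auto simp: sX)
    ultimately show ?thesis by simp
  qed
  have disj: "disjoint_family_on (\<lambda>k. {\<omega>\<in>space M. T k \<omega> \<and> Z k \<omega>}) {1..n}" for Z
    unfolding disjoint_family_on_def T_def by (auto, metis linorder_neqE_nat not_le)
  have mR: "?R k \<in> events" and mTn: "{\<omega>\<in>space M. T k \<omega> \<and> S n \<omega> \<le> a} \<in> events" if "k \<le> n" for k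
    using that by (intro sets.sets_Collect_conj mT borel_measurable_le; measurable)+
  have first: "\<exists>k\<in>{1..n}. T k \<omega>" if "S 0 \<omega> \<le> a" "k \<le> n" "S k \<omega> > a" for k \<omega>
  proof -
    define m where "m = (LEAST k. S k \<omega> > a)"
    have "S m \<omega> > a" "m \<le> k" unfolding m_def using that by (auto intro: LeastI Least_le)
    moreover have "0 < m" using calculation(1) that(1) by (cases m) auto
    moreover have "\<forall>j<m. S j \<omega> \<le> a" unfolding m_def by (metis (mono_tags, lifting) not_less_Least not_le)
    ultimately show ?thesis using that by (intro bexI[of _ m]) (auto simp: T_def)
  qed
  have T0: "S 0 \<omega> \<le> a" if "T k \<omega>" "k \<in> {1..n}" for k \<omega> using that by (auto simp: T_def)
  have mA: "?A \<in> events" and mS: "{\<omega>\<in>space M. S 0 \<omega> \<le> a \<and> S n \<omega> > b} \<in> events" 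
    and mI: "{\<omega>\<in>space M. \<exists>k\<in>{1..n}. \<bar>X k \<omega>\<bar> > e} \<in> events" for b
    by (intro sets.sets_Collect_conj sets.sets_Collect_finite_Ex borel_measurable_le borel_measurable_less; auto)+
  have split: "prob ?A = prob {\<omega>\<in>space M. S 0 \<omega> \<le> a \<and> S n \<omega> > a} + prob (\<Union>k\<in>{1..n}. ?R k)"
  proof -
    let ?U = "\<Union>k\<in>{1..n}. {\<omega>\<in>space M. T k \<omega> \<and> S n \<omega> \<le> a}"
    have "?A = {\<omega>\<in>space M. S 0 \<omega> \<le> a \<and> S n \<omega> > a} \<union> ?U"
      using first T0 by (auto simp: T_def) (meson not_le)
    moreover have "?U \<in> events" using mTn by (intro sets.finite_UN) auto
    ultimately have "prob ?A = prob {\<omega>\<in>space M. S 0 \<omega> \<le> a \<and> S n \<omega> > a} + prob ?U"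
      using mS[of a] by (subst finite_measure_Union[symmetric]) auto
    also have "prob ?U = (\<Sum>k\<in>{1..n}. prob {\<omega>\<in>space M. T k \<omega> \<and> S n \<omega> \<le> a})"
      using mTn disj by (intro finite_measure_finite_Union) auto
    also have "\<dots> = (\<Sum>k\<in>{1..n}. prob (?R k))" using flip by (intro sum.cong) auto
    also have "\<dots> = prob (\<Union>k\<in>{1..n}. ?R k)"
      using mR disj by (intro finite_measure_finite_Union[symmetric]) auto
    finally show ?thesis .
  qed
  have "prob (\<Union>k\<in>{1..n}. ?R k) \<le> prob {\<omega>\<in>space M. S 0 \<omega> \<le> a \<and> S n \<omega> > a}"
    by (intro finite_measure_mono mS) (auto simp: T_def)
  then show ?upper using split by simp
  have "{\<omega>\<in>space M. S 0 \<omega> \<le> a \<and> S n \<omega> > a + 2 * e} \<subseteq> (\<Union>k\<in>{1..n}. ?R k) \<union> {\<omega>\<in>space M. \<exists>k\<in>{1..n}. \<bar>X k \<omega>\<bar> > e}"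
  proof
    fix \<omega> assume "\<omega> \<in> {\<omega>\<in>space M. S 0 \<omega> \<le> a \<and> S n \<omega> > a + 2 * e}"
    then have \<omega>: "\<omega> \<in> space M" "S 0 \<omega> \<le> a" "S n \<omega> > a + 2 * e" by auto
    show "\<omega> \<in> (\<Union>k\<in>{1..n}. ?R k) \<union> {\<omega>\<in>space M. \<exists>k\<in>{1..n}. \<bar>X k \<omega>\<bar> > e}"
    proof (cases "\<exists>k\<in>{1..n}. \<bar>X k \<omega>\<bar> > e")
      case True then show ?thesis using \<omega> by auto
    next
      case no: False
    obtain k where k: "k \<in> {1..n}" "T k \<omega>" using first[of \<omega> n] \<omega> e by auto
    then obtain j where j: "k = Suc j" by (cases k) auto
    have "S k \<omega> = S j \<omega> + X k \<omega>" "S j \<omega> \<le> a" using k by (auto simp: S_def j T_def)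
    moreover have "\<bar>X k \<omega>\<bar> \<le> e" using no k(1) by (meson not_le)
    ultimately have "S k \<omega> \<le> a + e" by linarith
    then show ?thesis using k \<omega> by (auto intro!: bexI[of _ k])
    qed
  qed
  then have "prob {\<omega>\<in>space M. S 0 \<omega> \<le> a \<and> S n \<omega> > a + 2 * e} \<le>
      prob ((\<Union>k\<in>{1..n}. ?R k) \<union> {\<omega>\<in>space M. \<exists>k\<in>{1..n}. \<bar>X k \<omega>\<bar> > e})"
    by (intro finite_measure_mono sets.Un mI sets.finite_UN) (use mR in auto)
  also have "\<dots> \<le> prob (\<Union>k\<in>{1..n}. ?R k) + prob {\<omega>\<in>space M. \<exists>k\<in>{1..n}. \<bar>X k \<omega>\<bar> > e}"
    by (intro measure_Un_le mI sets.finite_UN) (use mR in auto)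
  finally show ?lower using split by simp
qed

text \<open>
  On equidistant grids of mesh tending to 0, path continuity lets the exceedance events of the sampled
  walk converge almost surely to the exceedance event of the path, while the probability of a step larger
  than any fixed \<open>e\<close> tends to 0. Exceedance at some time of a continuum need not be measurable; it is
  represented by a measurable event with which it agrees almost surely.
\<close>

lemma (in prob_space) reflection_principle:
  fixes W :: "real \<Rightarrow> 'a \<Rightarrow> real" and r0 r1 a :: real
  defines "\<rho> \<equiv> \<lambda>n k. r0 + (r1 - r0) * (real k / real n)"
  assumes r: "r0 < r1"
    and W: "\<And>r. r \<in> {r0..r1} \<Longrightarrow> random_variable borel (W r)"
    and cont: "AE \<omega> in M. continuous_on {r0..r1} (\<lambda>r. W r \<omega>)"
    and indep: "\<And>n. n > 0 \<Longrightarrow> indep_vars (\<lambda>_. borel)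
      (\<lambda>i \<omega>. if i = 0 then W r0 \<omega> else W (\<rho> n i) \<omega> - W (\<rho> n (i - 1)) \<omega>) {..n}"
    and sym: "\<And>s r. r0 \<le> s \<Longrightarrow> s < r \<Longrightarrow> r \<le> r1 \<Longrightarrow>
      distr M borel (\<lambda>\<omega>. - (W r \<omega> - W s \<omega>)) = distr M borel (\<lambda>\<omega>. W r \<omega> - W s \<omega>)"
  obtains A where "A \<in> events"
    and "AE \<omega> in M. \<omega> \<in> A \<longleftrightarrow> W r0 \<omega> \<le> a \<and> (\<exists>r\<in>{r0..r1}. W r \<omega> > a)"
    and "prob A = 2 * prob {\<omega>\<in>space M. W r0 \<omega> \<le> a \<and> W r1 \<omega> > a}"
proof -
  have \<rho>_in: "\<rho> n k \<in> {r0..r1}" if "n > 0" "k \<le> n" for n k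
  proof -
    have "0 \<le> real k / real n" "real k / real n \<le> 1" using that by auto
    then have "0 \<le> (r1 - r0) * (real k / real n)" "(r1 - r0) * (real k / real n) \<le> (r1 - r0) * 1"
      using r mult_left_mono[of "real k / real n" 1 "r1 - r0"] by (auto intro!: mult_nonneg_nonneg)
    then show ?thesis by (simp add: \<rho>_def)
  qed
  have \<rho>_step: "\<rho> n (Suc k) - \<rho> n k = (r1 - r0) / n" for n k
    by (simp add: \<rho>_def flip: right_diff_distrib diff_divide_distrib)
  have \<rho>0: "\<rho> n 0 = r0" for n by (simp add: \<rho>_def)
  have \<rho>n: "\<rho> n n = r1" if "n > 0" for n using that by (simp add: \<rho>_def)
  define X where "X = (\<lambda>n i \<omega>. if i = 0 then W r0 \<omega> else W (\<rho> n i) \<omega> - W (\<rho> n (i - 1)) \<omega>)"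
  have S: "(\<Sum>i\<le>k. X n i \<omega>) = W (\<rho> n k) \<omega>" for n k \<omega>
    by (induction k) (auto simp: X_def \<rho>0)
  have r0_in: "r0 \<in> {r0..r1}" and r1_in: "r1 \<in> {r0..r1}" using r by auto
  define A where "A = (\<lambda>n. {\<omega>\<in>space M. W r0 \<omega> \<le> a \<and> (\<exists>k\<le>n. W (\<rho> n k) \<omega> > a)})"
  define D where "D = (\<lambda>e n. {\<omega>\<in>space M. \<exists>k\<in>{1..n}. \<bar>X n k \<omega>\<bar> > e})"
  define B where "B = (\<lambda>b. {\<omega>\<in>space M. W r0 \<omega> \<le> a \<and> W r1 \<omega> > b})"
  have up: "prob (A n) \<le> 2 * prob (B a)"
    and low: "e > 0 \<Longrightarrow> prob (B a) + prob (B (a + 2 * e)) \<le> prob (A n) + prob (D e n)" if n: "n > 0" for n e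
  proof -
    have sym': "distr M borel (\<lambda>\<omega>. - X n i \<omega>) = distr M borel (X n i)" if i: "i \<in> {1..n}" for i
    proof -
      obtain j where j: "i = Suc j" using i by (cases i) auto
      have "distr M borel (\<lambda>\<omega>. - (W (\<rho> n i) \<omega> - W (\<rho> n j) \<omega>)) = distr M borel (\<lambda>\<omega>. W (\<rho> n i) \<omega> - W (\<rho> n j) \<omega>)"
      proof (rule sym)
        have "(r1 - r0) / n > 0" using n r by simp
        then show "\<rho> n j < \<rho> n i" using \<rho>_step[of n j] unfolding j by linarith
      qed (use \<rho>_in[of n i] \<rho>_in[of n j] n i j in auto)
      then show ?thesis by (simp add: X_def j)
    qed
    have indep': "indep_vars (\<lambda>_. borel) (X n) {..n}" unfolding X_def by (rule indep[OF n])
    note * = reflection_discrete[OF indep' sym', of _ a, unfolded S \<rho>0 \<rho>n[OF n]]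
    show "prob (A n) \<le> 2 * prob (B a)" using *(1)[of 1] by (simp add: A_def B_def)
    show "prob (B a) + prob (B (a + 2 * e)) \<le> prob (A n) + prob (D e n)" if "e > 0"
      using *(2)[of e] that unfolding A_def B_def D_def by simp
  qed
  define A' where "A' = (\<Union>n\<in>{0<..}. A n)"
  have mA: "A n \<in> events" if "n > 0" for n
    unfolding A_def using W r0_in \<rho>_in[OF that]
    by (intro sets.sets_Collect_conj sets.sets_Collect_finite_Ex borel_measurable_le borel_measurable_less) auto
  have mA': "A' \<in> events" unfolding A'_def using mA by (intro sets.countable_UN') auto
  have mB: "B b \<in> events" for b
    unfolding B_def using W r0_in r1_in
    by (intro sets.sets_Collect_conj borel_measurable_le borel_measurable_less) auto
  have mD: "D e n \<in> events" if "n > 0" for e n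
  proof -
    have "X n k \<in> borel_measurable M" if "k \<in> {1..n}" for k
      unfolding X_def using that W r0_in \<rho>_in[OF \<open>n > 0\<close>, of k] \<rho>_in[OF \<open>n > 0\<close>, of "k - 1"]
      by (cases "k = 0") auto
    then show ?thesis unfolding D_def
      by (intro sets.sets_Collect_finite_Ex borel_measurable_less borel_measurable_abs) auto
  qed
  \<comment> \<open>Grid points get arbitrarily close to any point of the interval.\<close>
  have approx: "\<forall>\<^sub>F n in sequentially. \<exists>k\<le>n. \<bar>\<rho> n k - s\<bar> < d" if "d > 0" "s \<in> {r0..r1}" for s d
  proof -
    have "\<forall>\<^sub>F n in sequentially. (r1 - r0) / d < real n"
      using filterlim_real_sequentially filterlim_at_top_dense by blast
    with eventually_gt_at_top[of 0] show ?thesis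
    proof eventually_elim
      case (elim n)
      define z where "z = (s - r0) / (r1 - r0) * n"
      have "0 \<le> (s - r0) / (r1 - r0)" "(s - r0) / (r1 - r0) \<le> 1"
        using that r by (auto simp: divide_le_eq)
      then have z: "0 \<le> z" "z \<le> n"
        unfolding z_def using mult_right_mono[of "(s - r0) / (r1 - r0)" 1 "real n"] by (auto simp del: times_divide_eq_left)
      define k where "k = nat \<lfloor>z\<rfloor>"
      have k: "real k \<le> z" "z < real k + 1" unfolding k_def using z by linarith+
      have zn: "(r1 - r0) * (z / n) = s - r0" using r elim unfolding z_def by simp
      have "\<rho> n k - s = (r1 - r0) * (k / n) - (r1 - r0) * (z / n)" unfolding zn by (simp add: \<rho>_def)
      also have "\<dots> = - ((r1 - r0) * ((z - k) / n))" unfolding diff_divide_distrib right_diff_distrib by linarith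
      finally have "\<rho> n k - s = - ((r1 - r0) * ((z - k) / n))" .
      moreover have "0 \<le> (r1 - r0) * ((z - k) / n)" using r k by (intro mult_nonneg_nonneg) auto
      moreover have "(r1 - r0) * ((z - k) / n) \<le> (r1 - r0) * (1 / n)"
        using r k elim by (intro mult_left_mono divide_right_mono) auto
      moreover have "(r1 - r0) * (1 / n) < d" using elim that r by (simp add: field_simps)
      ultimately have "\<bar>\<rho> n k - s\<bar> < d" by linarith
      moreover have "k \<le> n" using k z by linarith
      ultimately show ?case by blast
    qed
  qed
  have A'_iff: "AE \<omega> in M. \<omega> \<in> A' \<longleftrightarrow> W r0 \<omega> \<le> a \<and> (\<exists>r\<in>{r0..r1}. W r \<omega> > a)"
    and A_ev: "AE \<omega> in M. \<forall>\<^sub>F n in sequentially. \<omega> \<in> A (Suc n) \<longleftrightarrow> \<omega> \<in> A'"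
  proof -
    have key: "\<forall>\<^sub>F n in sequentially. \<omega> \<in> A n"
      if c: "continuous_on {r0..r1} (\<lambda>r. W r \<omega>)" and "\<omega> \<in> space M" "W r0 \<omega> \<le> a" "s \<in> {r0..r1}" "W s \<omega> > a" for \<omega> s
    proof -
      have "W s \<omega> - a > 0" using that by simp
      then have "\<exists>d>0. \<forall>s'\<in>{r0..r1}. dist s' s < d \<longrightarrow> dist (W s' \<omega>) (W s \<omega>) < W s \<omega> - a"
        using c that(4) unfolding continuous_on_iff by blast
      then obtain d where d: "d > 0" "\<And>s'. s' \<in> {r0..r1} \<Longrightarrow> dist s' s < d \<Longrightarrow> dist (W s' \<omega>) (W s \<omega>) < W s \<omega> - a"
        by blast
      show ?thesis using approx[OF d(1) that(4)] eventually_gt_at_top[of 0]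
      proof eventually_elim
        case (elim n)
        then obtain k where k: "k \<le> n" "\<bar>\<rho> n k - s\<bar> < d" by auto
        have "dist (W (\<rho> n k) \<omega>) (W s \<omega>) < W s \<omega> - a"
          using d(2)[of "\<rho> n k"] \<rho>_in elim k by (auto simp: dist_real_def)
        then have "W (\<rho> n k) \<omega> > a" by (simp add: dist_real_def abs_if split: if_splits)
        then show ?case using k that by (auto simp: A_def)
      qed
    qed
    have sub: "W r0 \<omega> \<le> a \<and> (\<exists>r\<in>{r0..r1}. W r \<omega> > a)" if \<omega>: "\<omega> \<in> A'" for \<omega>
    proof -
      obtain n k where "n > 0" "k \<le> n" "W r0 \<omega> \<le> a" "W (\<rho> n k) \<omega> > a"
        using \<omega> by (auto simp: A'_def A_def)
      then show ?thesis using \<rho>_in[of n k] by blast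
    qed
    show "AE \<omega> in M. \<omega> \<in> A' \<longleftrightarrow> W r0 \<omega> \<le> a \<and> (\<exists>r\<in>{r0..r1}. W r \<omega> > a)"
      using cont
    proof (rule AE_mp, intro AE_I2 impI iffI)
      fix \<omega> assume \<omega>: "\<omega> \<in> space M" "continuous_on {r0..r1} (\<lambda>r. W r \<omega>)"
        "W r0 \<omega> \<le> a \<and> (\<exists>r\<in>{r0..r1}. W r \<omega> > a)"
      then obtain s where "s \<in> {r0..r1}" "W s \<omega> > a" by auto
      with key[of \<omega> s] \<omega> have "\<forall>\<^sub>F n in sequentially. \<omega> \<in> A n" by auto
      with eventually_gt_at_top[of 0] have "\<forall>\<^sub>F n in sequentially. \<omega> \<in> A'"
        by eventually_elim (auto simp: A'_def)
      then show "\<omega> \<in> A'" by simp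
    qed (rule sub)
    show "AE \<omega> in M. \<forall>\<^sub>F n in sequentially. \<omega> \<in> A (Suc n) \<longleftrightarrow> \<omega> \<in> A'"
      using cont
    proof (rule AE_mp, intro AE_I2 impI)
      fix \<omega> assume \<omega>: "\<omega> \<in> space M" "continuous_on {r0..r1} (\<lambda>r. W r \<omega>)"
      show "\<forall>\<^sub>F n in sequentially. \<omega> \<in> A (Suc n) \<longleftrightarrow> \<omega> \<in> A'"
      proof (cases "\<omega> \<in> A'")
        case True
        then obtain s where "s \<in> {r0..r1}" "W s \<omega> > a" "W r0 \<omega> \<le> a" using sub by blast
        with key[of \<omega> s] \<omega> have "\<forall>\<^sub>F n in sequentially. \<omega> \<in> A n" by auto
        then have "\<forall>\<^sub>F n in sequentially. \<omega> \<in> A (Suc n)" by (rule eventually_compose_filterlim[OF _ filterlim_Suc])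
        then show ?thesis using True by simp
      next
        case False
        then show ?thesis by (auto simp: A'_def)
      qed
    qed
  qed
  have limA: "(\<lambda>n. prob (A (Suc n))) \<longlonglongrightarrow> prob A'"
    by (rule prob_tendsto_AE[OF _ mA' A_ev]) (simp add: mA)
  have limD: "(\<lambda>n. prob (D e (Suc n))) \<longlonglongrightarrow> prob {}" if e: "e > 0" for e
  proof (rule prob_tendsto_AE)
    show "AE \<omega> in M. \<forall>\<^sub>F n in sequentially. \<omega> \<in> D e (Suc n) \<longleftrightarrow> \<omega> \<in> {}"
      using cont
    proof eventually_elim
      case (elim \<omega>)
      have "uniformly_continuous_on {r0..r1} (\<lambda>r. W r \<omega>)"
        using elim by (rule compact_uniformly_continuous) simp
      then have "\<exists>d>0. \<forall>s\<in>{r0..r1}. \<forall>s'\<in>{r0..r1}. dist s' s < d \<longrightarrow> dist (W s' \<omega>) (W s \<omega>) < e"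
        unfolding uniformly_continuous_on_def using e by blast
      then obtain d where d: "d > 0" "\<And>s s'. s \<in> {r0..r1} \<Longrightarrow> s' \<in> {r0..r1} \<Longrightarrow> dist s' s < d \<Longrightarrow> dist (W s' \<omega>) (W s \<omega>) < e"
        by blast
      have "\<forall>\<^sub>F n in sequentially. (r1 - r0) / d < real n"
        using filterlim_real_sequentially filterlim_at_top_dense by blast
      with eventually_gt_at_top[of 0] have "\<forall>\<^sub>F n in sequentially. \<omega> \<notin> D e n"
      proof eventually_elim
        case (elim n)
        have "\<bar>X n k \<omega>\<bar> \<le> e" if k: "k \<in> {1..n}" for k
        proof -
          obtain j where j: "k = Suc j" using k by (cases k) auto
          have "(r1 - r0) / n < d" using elim d by (simp add: field_simps)
          moreover have "(r1 - r0) / n > 0" using elim r by simp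
          ultimately have "dist (\<rho> n k) (\<rho> n j) < d" using \<rho>_step[of n j] unfolding j dist_real_def by linarith
          then have "dist (W (\<rho> n k) \<omega>) (W (\<rho> n j) \<omega>) < e"
            using d(2) \<rho>_in elim k j by auto
          then show ?thesis by (simp add: X_def j dist_real_def)
        qed
        then show ?case by (auto simp: D_def not_less)
      qed
      then have "\<forall>\<^sub>F n in sequentially. \<omega> \<notin> D e (Suc n)"
        by (rule eventually_compose_filterlim[OF _ filterlim_Suc])
      then show ?case by simp
    qed
  qed (use mD in auto)
  have le: "prob A' \<le> 2 * prob (B a)"
    by (rule LIMSEQ_le_const2[OF limA]) (use up in auto)
  have ge: "prob (B a) + prob (B (a + 2 * e)) \<le> prob A'" if "e > 0" for e
  proof -
    have "(\<lambda>n. prob (A (Suc n)) + prob (D e (Suc n))) \<longlonglongrightarrow> prob A' + prob {}"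
      by (intro tendsto_add limA limD that)
    then show ?thesis
      by (intro LIMSEQ_le_const[where X="\<lambda>n. prob (A (Suc n)) + prob (D e (Suc n))"]) (use low that in auto)
  qed
  have "(\<lambda>n. prob (B (a + 2 * (1 / real (Suc n))))) \<longlonglongrightarrow> prob (B a)"
  proof (rule prob_tendsto_AE[OF mB mB], intro AE_I2)
    fix \<omega>
    show "\<forall>\<^sub>F n in sequentially. \<omega> \<in> B (a + 2 * (1 / real (Suc n))) \<longleftrightarrow> \<omega> \<in> B a"
    proof (cases "W r1 \<omega> > a")
      case True
      have "(\<lambda>n. a + 2 * (1 / real (Suc n))) \<longlonglongrightarrow> a + 2 * 0"
        by (intro tendsto_intros LIMSEQ_Suc[OF lim_1_over_n])
      then have "\<forall>\<^sub>F n in sequentially. a + 2 * (1 / real (Suc n)) < W r1 \<omega>"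
        using True by (intro order_tendstoD(2)) auto
      then show ?thesis by eventually_elim (use True in \<open>auto simp: B_def\<close>)
    next
      case False
      then have "\<omega> \<notin> B (a + 2 * (1 / real (Suc n)))" for n
      proof -
        have "1 / real (Suc n) > 0" by simp
        then show ?thesis using False unfolding B_def mem_Collect_eq by linarith
      qed
      then show ?thesis using False by (simp add: B_def)
    qed
  qed
  then have "(\<lambda>n. prob (B a) + prob (B (a + 2 * (1 / real (Suc n))))) \<longlonglongrightarrow> prob (B a) + prob (B a)"
    by (intro tendsto_intros)
  then have "prob (B a) + prob (B a) \<le> prob A'"
    by (rule LIMSEQ_le_const2) (intro exI allI impI ge, simp)
  with le have "prob A' = 2 * prob (B a)" by simp
  then show thesis using that[of A'] mA' A'_iff by (simp add: B_def)
qed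

section \<open>Normal distributions and hitting times of Brownian motion\<close>

lemma normal_density_0_uminus: "normal_density 0 \<sigma> (- x) = normal_density 0 \<sigma> x"
  by (simp add: normal_density_def)

lemma hitting_cdf_uminus [simp]: "hitting_cdf (- a) s = hitting_cdf a s"
  by (simp add: hitting_cdf_def)

lemma (in prob_space) normal_symmetric:
  assumes X: "distributed M lborel X (normal_density 0 \<sigma>)" and "\<sigma> > 0"
  shows "distributed M lborel (\<lambda>\<omega>. - X \<omega>) (normal_density 0 \<sigma>)"
  using normal_density_affine[OF X, of "-1" 0] assms by simp

lemma (in prob_space) normal_distr_symmetric:
  assumes X: "distributed M lborel X (normal_density 0 \<sigma>)" and "\<sigma> > 0"
  shows "distr M borel (\<lambda>\<omega>. - X \<omega>) = distr M borel X"
proof -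
  have "distr M lborel (\<lambda>\<omega>. - X \<omega>) = distr M lborel X"
    using distributed_distr_eq_density[OF X] distributed_distr_eq_density[OF normal_symmetric[OF assms]] by simp
  moreover have "distr M lborel Z = distr M borel Z" for Z :: "'a \<Rightarrow> real"
    by (rule distr_cong) auto
  ultimately show ?thesis by simp
qed

lemma (in prob_space) normal_AE_neq:
  assumes X: "distributed M lborel X (normal_density 0 \<sigma>)"
  shows "AE \<omega> in M. X \<omega> \<noteq> a"
  using AE_lborel_singleton[of a] by (subst distributed_AE2[OF X]) (auto elim!: eventually_mono)

lemma (in prob_space) normal_prob_set_integral:
  assumes X: "distributed M lborel X (normal_density 0 \<sigma>)" and S[measurable]: "S \<in> sets borel"
  shows "prob {\<omega>\<in>space M. X \<omega> \<in> S} = (LINT y:S|lborel. normal_density 0 \<sigma> y)"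
proof -
  have [measurable]: "X \<in> borel_measurable M" using distributed_measurable[OF X] by simp
  have "{\<omega>\<in>space M. X \<omega> \<in> S} = X -` S \<inter> space M" by auto
  then have "prob {\<omega>\<in>space M. X \<omega> \<in> S} = expectation (\<lambda>\<omega>. indicator S (X \<omega>))"
    by (subst integral_distr[symmetric, where N=borel]) (simp_all add: measure_distr)
  also have "\<dots> = (LINT y:S|lborel. normal_density 0 \<sigma> y)"
    using distributed_integral[OF X, of "indicator S"]
    by (simp add: set_lebesgue_integral_def mult.commute)
  finally show ?thesis .
qed

lemma (in prob_space) normal_tail:
  assumes X: "distributed M lborel X (normal_density 0 (sqrt s))" and s: "s > 0" and a: "0 \<le> a"
  shows "2 * prob {\<omega>\<in>space M. X \<omega> > a} = hitting_cdf a s"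
proof -
  have [measurable]: "X \<in> borel_measurable M" using distributed_measurable[OF X] by simp
  have "AE \<omega> in M. X \<omega> > a \<longleftrightarrow> X \<omega> \<ge> a"
    using normal_AE_neq[OF X, of a] by eventually_elim auto
  then have "prob {\<omega>\<in>space M. X \<omega> > a} = prob {\<omega>\<in>space M. X \<omega> \<ge> a}"
    by (intro finite_measure_eq_AE) auto
  also have "\<dots> = (LINT u:{a..}|lborel. normal_density 0 (sqrt s) u)"
    using normal_prob_set_integral[OF X, of "{a..}"] by simp
  also have "\<dots> = (LINT u:{a..}|lborel. 1 / sqrt (2 * pi * s) * exp (- u\<^sup>2 / (2 * s)))"
    using s by (simp add: normal_density_def)
  also have "\<dots> = 1 / sqrt (2 * pi * s) * (LINT u:{a..}|lborel. exp (- u\<^sup>2 / (2 * s)))"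
    by (rule set_integral_mult_right)
  finally show ?thesis using a by (simp add: hitting_cdf_def)
qed

text \<open>A centred normal law charges both half-lines equally and does not charge 0.\<close>

lemma hitting_cdf_0:
  assumes s: "s > 0"
  shows "hitting_cdf 0 s = 1"
proof -
  define N where "N = density lborel (normal_density 0 (sqrt s))"
  interpret N: prob_space N unfolding N_def by (rule prob_space_normal_density) (use s in simp)
  have X: "distributed N lborel (\<lambda>x. x) (normal_density 0 (sqrt s))"
    unfolding distributed_def N_def by (auto simp: distr_id2)
  have sp: "space N = UNIV" "sets N = sets borel" by (auto simp: N_def)
  have "N.prob {x\<in>space N. x > 0} = N.prob {x\<in>space N. - x > 0}"
    using N.normal_tail[OF X s, of 0] N.normal_tail[OF N.normal_symmetric[OF X] s, of 0] s by simp
  moreover have "N.prob ({x\<in>space N. x > 0} \<union> {x\<in>space N. - x > 0}) = N.prob {x\<in>space N. x > 0} + N.prob {x\<in>space N. - x > 0}"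
    by (rule N.finite_measure_Union) (auto simp: sp)
  moreover have "N.prob ({x\<in>space N. x > 0} \<union> {x\<in>space N. - x > 0}) = 1"
    using N.normal_AE_neq[OF X, of 0] by (subst N.prob_eq_1) (auto simp: sp elim!: eventually_mono)
  ultimately show ?thesis using N.normal_tail[OF X s, of 0] by simp
qed

lemma (in prob_space) char_indep_vars_sum:
  fixes X :: "'i \<Rightarrow> 'a \<Rightarrow> real"
  assumes indep: "indep_vars (\<lambda>_. borel) X I"
  shows "(CLINT \<omega>|M. iexp (\<Sum>i\<in>I. t i * X i \<omega>)) = (\<Prod>i\<in>I. char (distr M borel (X i)) (t i))"
proof -
  have X[measurable]: "\<And>i. i \<in> I \<Longrightarrow> random_variable borel (X i)"
    using indep by (auto simp: indep_vars_def)
  have Y: "indep_vars (\<lambda>_. borel) (\<lambda>i \<omega>. t i * X i \<omega>) I"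
    by (rule indep_vars_compose2[OF indep]) auto
  have "(\<lambda>\<omega>. \<Sum>i\<in>I. t i * X i \<omega>) \<in> borel_measurable M"
    by (intro borel_measurable_sum borel_measurable_times borel_measurable_const X)
  then have "(CLINT \<omega>|M. iexp (\<Sum>i\<in>I. t i * X i \<omega>)) = char (distr M borel (\<lambda>\<omega>. \<Sum>i\<in>I. t i * X i \<omega>)) 1"
    by (subst char_distr) auto
  also have "\<dots> = (\<Prod>i\<in>I. char (distr M borel (\<lambda>\<omega>. t i * X i \<omega>)) 1)"
    by (rule char_distr_sum[OF Y])
  also have "\<dots> = (\<Prod>i\<in>I. char (distr M borel (X i)) (t i))"
    by (intro prod.cong refl) (simp add: char_distr)
  finally show ?thesis .
qed

text \<open>
  The reflection principle counts the starting value among the independent variables; here a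
  deterministic one is put in front of the increments.
\<close>

lemma (in prob_space) indep_vars_shift_const:
  fixes X :: "nat \<Rightarrow> 'a \<Rightarrow> real"
  assumes indep: "indep_vars (\<lambda>_. borel) X {..<n}"
  shows "indep_vars (\<lambda>_. borel) (\<lambda>i \<omega>. case i of 0 \<Rightarrow> c | Suc j \<Rightarrow> X j \<omega>) {..n}"
proof (rule indep_vars_of_char)
  let ?Y = "\<lambda>i \<omega>. case i of 0 \<Rightarrow> c | Suc j \<Rightarrow> X j \<omega>"
  have X[measurable]: "\<And>i. i < n \<Longrightarrow> random_variable borel (X i)"
    using indep by (auto simp: indep_vars_def)
  show "random_variable borel (?Y i)" if "i \<in> {..n}" for i
    using that by (cases i) auto
  show "(CLINT \<omega>|M. iexp (\<Sum>i\<le>n. t i * ?Y i \<omega>)) = (\<Prod>i\<le>n. char (distr M borel (?Y i)) (t i))" for t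
  proof -
    have "(CLINT \<omega>|M. iexp (\<Sum>i\<le>n. t i * ?Y i \<omega>)) = (CLINT \<omega>|M. iexp (t 0 * c) * iexp (\<Sum>i<n. t (Suc i) * X i \<omega>))"
      by (intro Bochner_Integration.integral_cong refl)
         (simp add: sum.atMost_shift exp_add[symmetric] distrib_left)
    also have "\<dots> = iexp (t 0 * c) * (\<Prod>i<n. char (distr M borel (X i)) (t (Suc i)))"
      by (simp only: char_indep_vars_sum[OF indep, symmetric] integral_mult_right_zero)
    also have "\<dots> = (\<Prod>i\<le>n. char (distr M borel (?Y i)) (t i))"
      by (simp add: prod.atMost_shift char_distr prob_space)
    finally show ?thesis .
  qed
qed auto

text \<open>
  Subtracting \<open>w 0\<close>, which vanishes only almost surely, makes the starting value exactly constant.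
\<close>

lemma (in prob_space) brownian_exceeds_level:
  assumes bm: "brownian_motion M w" and s: "s > 0" and b: "b \<ge> 0"
  obtains A where "A \<in> events" and "AE \<omega> in M. \<omega> \<in> A \<longleftrightarrow> (\<exists>r\<in>{0..s}. w r \<omega> > b)"
    and "prob A = hitting_cdf b s"
proof -
  define W where "W = (\<lambda>r \<omega>. w r \<omega> - w 0 \<omega>)"
  have w[measurable]: "w r \<in> borel_measurable M" if "r \<ge> 0" for r
    using bm that by (auto simp: brownian_motion_def)
  have w0: "AE \<omega> in M. w 0 \<omega> = 0" and wc: "AE \<omega> in M. continuous_on {0..} (\<lambda>s. w s \<omega>)"
    using bm by (auto simp: brownian_motion_def)
  have incr: "distributed M lborel (\<lambda>\<omega>. w r \<omega> - w q \<omega>) (normal_density 0 (sqrt (r - q)))" if "0 \<le> q" "q < r" for q r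
    using bm that by (auto simp: brownian_motion_def)
  obtain A where A: "A \<in> events" "AE \<omega> in M. \<omega> \<in> A \<longleftrightarrow> W 0 \<omega> \<le> b \<and> (\<exists>r\<in>{0..s}. W r \<omega> > b)"
    "prob A = 2 * prob {\<omega>\<in>space M. W 0 \<omega> \<le> b \<and> W s \<omega> > b}"
  proof (rule reflection_principle[of 0 s W b])
    show "random_variable borel (W r)" if "r \<in> {0..s}" for r
      unfolding W_def using that w by (intro borel_measurable_diff) auto
    show "AE \<omega> in M. continuous_on {0..s} (\<lambda>r. W r \<omega>)"
      using wc
    proof eventually_elim
      case (elim \<omega>)
      then have "continuous_on {0..s} (\<lambda>r. w r \<omega>)" by (rule continuous_on_subset) auto
      then show ?case unfolding W_def by (intro continuous_intros)
    qed
    show "distr M borel (\<lambda>\<omega>. - (W r \<omega> - W q \<omega>)) = distr M borel (\<lambda>\<omega>. W r \<omega> - W q \<omega>)"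
      if "0 \<le> q" "q < r" "r \<le> s" for q r
      using normal_distr_symmetric[OF incr[of q r]] that by (simp add: W_def)
    show "indep_vars (\<lambda>_. borel)
          (\<lambda>i \<omega>. if i = 0 then W 0 \<omega>
                 else W (0 + (s - 0) * (real i / real n)) \<omega> - W (0 + (s - 0) * (real (i - 1) / real n)) \<omega>)
          {..n}" if n: "0 < n" for n
    proof -
      define \<rho> where "\<rho> = (\<lambda>i. s * (real i / real n))"
      have "strict_mono_on {..n} \<rho>"
        using n s by (intro strict_mono_onI) (auto simp: \<rho>_def divide_strict_right_mono)
      moreover have "\<rho> 0 \<ge> 0" by (simp add: \<rho>_def)
      ultimately have "indep_vars (\<lambda>_. borel) (\<lambda>i \<omega>. w (\<rho> (Suc i)) \<omega> - w (\<rho> i) \<omega>) {..<n}"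
        using bm by (auto simp: brownian_motion_def)
      then have "indep_vars (\<lambda>_. borel) (\<lambda>i \<omega>. case i of 0 \<Rightarrow> 0 | Suc j \<Rightarrow> w (\<rho> (Suc j)) \<omega> - w (\<rho> j) \<omega>) {..n}"
        by (rule indep_vars_shift_const)
      also have "(\<lambda>i \<omega>. case i of 0 \<Rightarrow> 0 | Suc j \<Rightarrow> w (\<rho> (Suc j)) \<omega> - w (\<rho> j) \<omega>) =
          (\<lambda>i \<omega>. if i = 0 then W 0 \<omega>
                 else W (0 + (s - 0) * (real i / real n)) \<omega> - W (0 + (s - 0) * (real (i - 1) / real n)) \<omega>)"
        by (intro ext) (auto simp: W_def \<rho>_def split: nat.split)
      finally show ?thesis .
    qed
  qed (use s in auto)
  have Ws: "distributed M lborel (W s) (normal_density 0 (sqrt s))"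
    using incr[of 0 s] s by (simp add: W_def)
  have "{\<omega>\<in>space M. W 0 \<omega> \<le> b \<and> W s \<omega> > b} = {\<omega>\<in>space M. W s \<omega> > b}"
    using b by (simp add: W_def)
  then have "prob A = hitting_cdf b s"
    using normal_tail[OF Ws s b] A(3) by simp
  moreover have "AE \<omega> in M. \<omega> \<in> A \<longleftrightarrow> (\<exists>r\<in>{0..s}. w r \<omega> > b)"
    using A(2) w0 by eventually_elim (use b in \<open>auto simp: W_def\<close>)
  ultimately show thesis using that A(1) by blast
qed

text \<open>
  The times at which a continuous path sits at \<open>a\<close> form a closed set, so the infimum is attained.
\<close>

lemma hitting_time_le_iff:
  assumes c: "continuous_on {0..} (\<lambda>r. w r \<omega>)"
  shows "hitting_time w a \<omega> \<le> ereal s \<longleftrightarrow> (\<exists>r\<in>{0..s}. w r \<omega> = a)"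
proof
  assume le: "hitting_time w a \<omega> \<le> ereal s"
  let ?S = "{0..} \<inter> (\<lambda>r. w r \<omega>) -` {a}"
  have "closed ?S" by (intro continuous_closed_preimage c) auto
  have bb: "bdd_below ?S" by (intro bdd_belowI[of _ 0]) auto
  have "?S \<noteq> {}"
  proof
    assume "?S = {}"
    then have empty: "{ereal r | r. 0 \<le> r \<and> w r \<omega> = a} = {}" by auto
    show False using le unfolding hitting_time_def empty by (simp add: top_ereal_def)
  qed
  then have i: "Inf ?S \<in> ?S" using bb \<open>closed ?S\<close> by (rule closed_contains_Inf)
  have "ereal (Inf ?S) \<le> hitting_time w a \<omega>"
    unfolding hitting_time_def
  proof (rule Inf_greatest)
    fix z assume "z \<in> {ereal r | r. 0 \<le> r \<and> w r \<omega> = a}"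
    then obtain r where r: "z = ereal r" "r \<in> ?S" by auto
    have "Inf ?S \<le> r" by (rule cInf_lower[OF r(2) bb])
    then show "ereal (Inf ?S) \<le> z" using r(1) by simp
  qed
  from order_trans[OF this le] have "Inf ?S \<le> s" by simp
  then show "\<exists>r\<in>{0..s}. w r \<omega> = a" using i by auto
next
  assume "\<exists>r\<in>{0..s}. w r \<omega> = a"
  then obtain r where r: "0 \<le> r" "r \<le> s" "w r \<omega> = a" by auto
  then have "hitting_time w a \<omega> \<le> ereal r" unfolding hitting_time_def by (intro Inf_lower) auto
  also have "\<dots> \<le> ereal s" using r by simp
  finally show "hitting_time w a \<omega> \<le> ereal s" .
qed

lemma measure_completion_AE_eq:
  assumes A: "A \<in> sets M" and ae: "AE \<omega> in M. \<omega> \<in> A \<longleftrightarrow> \<omega> \<in> B" and B: "B \<subseteq> space M"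
  shows "measure (completion M) B = measure M A"
proof -
  have ae': "AE \<omega> in completion M. \<omega> \<in> A \<longleftrightarrow> \<omega> \<in> B" using ae by (rule AE_completion)
  have "B \<in> sets (completion M)"
    by (rule completion.in_sets_AE[OF ae']) (use A B in auto)
  then have "measure (completion M) B = measure (completion M) A"
    using A ae' by (intro measure_eq_AE) auto
  then show ?thesis using A by simp
qed

text \<open>
  Reaching \<open>a\<close> lies between exceeding \<open>a\<close> and exceeding every level below \<open>a\<close>. The probabilities of
  exceeding levels \<open>b n\<close> that increase to \<open>a\<close> converge to that of exceeding \<open>a\<close>, so all three events agree
  almost surely. In particular this makes the event of reaching \<open>a\<close> measurable in the completion.
\<close>

lemma hitting_time_distribution_pos:
  assumes bm: "brownian_motion Q w" and s: "s > 0" and a: "a > 0"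
  shows "measure (completion Q) {\<omega>\<in>space Q. hitting_time w a \<omega> \<le> ereal s} = hitting_cdf a s"
proof -
  interpret prob_space Q using bm by (simp add: brownian_motion_def)
  have w0: "AE \<omega> in Q. w 0 \<omega> = 0" and wc: "AE \<omega> in Q. continuous_on {0..} (\<lambda>s. w s \<omega>)"
    using bm by (auto simp: brownian_motion_def)
  have ws: "distributed Q lborel (\<lambda>\<omega>. w s \<omega> - w 0 \<omega>) (normal_density 0 (sqrt s))"
  proof -
    have "0 \<le> (0::real) \<and> 0 < s \<longrightarrow> distributed Q lborel (\<lambda>\<omega>. w s \<omega> - w 0 \<omega>) (normal_density 0 (sqrt (s - 0)))"
      using bm unfolding brownian_motion_def by blast
    then show ?thesis using s by simp
  qed
  \<comment> \<open>Levels increasing to \<open>a\<close>; the first one is 0, so none of them is negative.\<close>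
  define b where "b = (\<lambda>n. a - a / real (Suc n))"
  have b0: "0 \<le> b n" "b n < a" for n
    using a frac_le[of a a 1 "real (Suc n)"] by (auto simp: b_def)
  obtain A where A: "A \<in> events" "AE \<omega> in Q. \<omega> \<in> A \<longleftrightarrow> (\<exists>r\<in>{0..s}. w r \<omega> > a)" "prob A = hitting_cdf a s"
    using brownian_exceeds_level[OF bm s, of a] a by auto
  have "\<exists>B. B \<in> events \<and> (AE \<omega> in Q. \<omega> \<in> B \<longleftrightarrow> (\<exists>r\<in>{0..s}. w r \<omega> > b n)) \<and> prob B = hitting_cdf (b n) s" for n
    by (rule brownian_exceeds_level[OF bm s b0(1)[of n]]) blast
  then obtain B where "\<forall>n. B n \<in> events \<and> (AE \<omega> in Q. \<omega> \<in> B n \<longleftrightarrow> (\<exists>r\<in>{0..s}. w r \<omega> > b n)) \<and> prob (B n) = hitting_cdf (b n) s"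
    using choice[of "\<lambda>n B. B \<in> events \<and> (AE \<omega> in Q. \<omega> \<in> B \<longleftrightarrow> (\<exists>r\<in>{0..s}. w r \<omega> > b n)) \<and> prob B = hitting_cdf (b n) s"]
    by blast
  then have B: "\<And>n. B n \<in> events" "\<And>n. AE \<omega> in Q. \<omega> \<in> B n \<longleftrightarrow> (\<exists>r\<in>{0..s}. w r \<omega> > b n)"
    "\<And>n. prob (B n) = hitting_cdf (b n) s" by blast+
  have "\<forall>n. AE \<omega> in Q. \<omega> \<in> B n \<longleftrightarrow> (\<exists>r\<in>{0..s}. w r \<omega> > b n)" using B(2) by simp
  then have B': "AE \<omega> in Q. \<forall>n. \<omega> \<in> B n \<longleftrightarrow> (\<exists>r\<in>{0..s}. w r \<omega> > b n)" by (simp add: AE_all_countable)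
  define E where "E = (\<Inter>n. B n)"
  have E: "E \<in> events" unfolding E_def using B(1) by auto
  let ?X = "\<lambda>\<omega>. w s \<omega> - w 0 \<omega>"
  have [measurable]: "?X \<in> borel_measurable Q" using distributed_measurable[OF ws] by simp
  have "(\<lambda>n. prob {\<omega>\<in>space Q. ?X \<omega> > b n}) \<longlonglongrightarrow> prob {\<omega>\<in>space Q. ?X \<omega> > a}"
  proof (rule prob_tendsto_AE)
    show "AE \<omega> in Q. \<forall>\<^sub>F n in sequentially. \<omega> \<in> {\<omega>\<in>space Q. ?X \<omega> > b n} \<longleftrightarrow> \<omega> \<in> {\<omega>\<in>space Q. ?X \<omega> > a}"
      using normal_AE_neq[OF ws, of a]
    proof eventually_elim
      case (elim \<omega>)
      show ?case
      proof (cases "?X \<omega> > a")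
        case True
        then have "?X \<omega> > b n" for n using b0(2)[of n] by linarith
        then show ?thesis using True by simp
      next
        case False
        have "(\<lambda>n. a - a / real (Suc n)) \<longlonglongrightarrow> a - 0"
          by (intro tendsto_intros LIMSEQ_Suc[OF lim_const_over_n])
        then have "b \<longlonglongrightarrow> a" by (simp add: b_def)
        then have "\<forall>\<^sub>F n in sequentially. b n > ?X \<omega>" using elim False by (intro order_tendstoD(1)) auto
        then show ?thesis by eventually_elim (use False in auto)
      qed
    qed
  qed measurable
  then have "(\<lambda>n. 2 * prob {\<omega>\<in>space Q. ?X \<omega> > b n}) \<longlonglongrightarrow> 2 * prob {\<omega>\<in>space Q. ?X \<omega> > a}"
    by (intro tendsto_intros)
  then have lim: "(\<lambda>n. prob (B n)) \<longlonglongrightarrow> prob A"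
    using normal_tail[OF ws s b0(1)] normal_tail[OF ws s, of a] a A(3) B(3) by simp
  have "prob E \<le> prob A"
  proof (rule LIMSEQ_le_const[OF lim], intro exI allI impI)
    show "prob E \<le> prob (B n)" for n
      by (rule finite_measure_mono) (use B(1) in \<open>auto simp: E_def\<close>)
  qed
  moreover have AE: "AE \<omega> in Q. \<omega> \<in> A \<longrightarrow> \<omega> \<in> E"
    using A(2) B'
  proof eventually_elim
    case (elim \<omega>)
    have "\<exists>r\<in>{0..s}. w r \<omega> > b n" if r: "r \<in> {0..s}" "w r \<omega> > a" for r n
      using less_trans[OF b0(2) r(2)] r(1) by blast
    then show ?case using elim by (auto simp: E_def)
  qed
  ultimately have "prob (E - A) = 0"
  proof -
    have "prob A \<le> prob (E \<inter> A)" using AE A(1) E by (intro finite_measure_mono_AE) auto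
    moreover have "prob (E - A) = prob E - prob (E \<inter> A)" using E A(1) by (rule finite_measure_Diff')
    ultimately show ?thesis using \<open>prob E \<le> prob A\<close> measure_nonneg[of Q "E - A"] by linarith
  qed
  then have EA: "AE \<omega> in Q. \<omega> \<in> E \<longrightarrow> \<omega> \<in> A"
    using E A(1) by (subst (asm) prob_eq_0) (auto elim!: eventually_mono)
  have "AE \<omega> in Q. \<omega> \<in> A \<longleftrightarrow> \<omega> \<in> {\<omega>\<in>space Q. hitting_time w a \<omega> \<le> ereal s}"
    using A(2) B' EA w0 wc AE_space
  proof eventually_elim
    case (elim \<omega>)
    have "\<exists>r\<in>{0..s}. w r \<omega> = a" if \<omega>: "\<omega> \<in> A"
    proof -
      obtain r where r: "r \<in> {0..s}" "w r \<omega> > a" using elim \<omega> by auto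
      have "\<exists>x\<ge>0. x \<le> r \<and> w x \<omega> = a"
        by (rule IVT') (use r elim a in \<open>auto intro: continuous_on_subset\<close>)
      then show ?thesis using r by auto
    qed
    moreover have "\<omega> \<in> A" if "\<exists>r\<in>{0..s}. w r \<omega> = a"
    proof -
      have "\<omega> \<in> B n" for n using that elim(2) b0(2)[of n] by auto
      then show ?thesis using elim(3) by (auto simp: E_def)
    qed
    ultimately show ?case using hitting_time_le_iff[of w \<omega> a s, OF elim(5)] elim(6) by auto
  qed
  then show ?thesis using measure_completion_AE_eq[OF A(1)] A(3) by simp
qed

lemma brownian_motion_uminus:
  assumes bm: "brownian_motion Q w"
  shows "brownian_motion Q (\<lambda>r \<omega>. - w r \<omega>)"
proof -
  interpret prob_space Q using bm by (simp add: brownian_motion_def)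
  have "indep_vars (\<lambda>_. borel) (\<lambda>i \<omega>. - w (r (Suc i)) \<omega> - - w (r i) \<omega>) {..<n}"
    if "0 \<le> r 0" "strict_mono_on {..n} r" for n and r :: "nat \<Rightarrow> real"
  proof -
    have "indep_vars (\<lambda>_. borel) (\<lambda>i \<omega>. w (r (Suc i)) \<omega> - w (r i) \<omega>) {..<n}"
      using bm that by (auto simp: brownian_motion_def)
    then have "indep_vars (\<lambda>_. borel) (\<lambda>i \<omega>. - (w (r (Suc i)) \<omega> - w (r i) \<omega>)) {..<n}"
      by (rule indep_vars_compose2) auto
    then show ?thesis by simp
  qed
  moreover have "distributed Q lborel (\<lambda>\<omega>. - w r \<omega> - - w q \<omega>) (normal_density 0 (sqrt (r - q)))"
    if "0 \<le> q" "q < r" for q r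
  proof -
    have "distributed Q lborel (\<lambda>\<omega>. - (w r \<omega> - w q \<omega>)) (normal_density 0 (sqrt (r - q)))"
      using bm that by (intro normal_symmetric) (auto simp: brownian_motion_def)
    then show ?thesis by simp
  qed
  moreover have "AE \<omega> in Q. continuous_on {0..} (\<lambda>r. w r \<omega>)" using bm by (simp add: brownian_motion_def)
  then have "AE \<omega> in Q. continuous_on {0..} (\<lambda>r. - w r \<omega>)"
    by eventually_elim (intro continuous_intros)
  ultimately show ?thesis
    using bm by (simp add: brownian_motion_def)
qed

lemma hitting_time_distribution:
  assumes bm: "brownian_motion Q w" and s: "s > 0"
  shows "measure (completion Q) {\<omega>\<in>space Q. hitting_time w a \<omega> \<le> ereal s} = hitting_cdf a s"
proof (cases a "0 :: real" rule: linorder_cases)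
  case less
  have "hitting_time (\<lambda>r \<omega>. - w r \<omega>) (- a) = hitting_time w a"
    by (intro ext) (simp add: hitting_time_def)
  then show ?thesis
    using hitting_time_distribution_pos[OF brownian_motion_uminus[OF bm] s, of "- a"] less by simp
next
  case greater
  then show ?thesis by (rule hitting_time_distribution_pos[OF bm s])
next
  case equal
  interpret prob_space Q using bm by (simp add: brownian_motion_def)
  have w0: "AE \<omega> in Q. w 0 \<omega> = 0" and wc: "AE \<omega> in Q. continuous_on {0..} (\<lambda>s. w s \<omega>)"
    using bm by (auto simp: brownian_motion_def)
  have "AE \<omega> in Q. \<omega> \<in> space Q \<longleftrightarrow> \<omega> \<in> {\<omega>\<in>space Q. hitting_time w a \<omega> \<le> ereal s}"
    using w0 wc
  proof eventually_elim
    case (elim \<omega>)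
    then show ?case using hitting_time_le_iff[of w \<omega> a s, OF elim(2)] s equal by force
  qed
  then have "measure (completion Q) {\<omega>\<in>space Q. hitting_time w a \<omega> \<le> ereal s} = prob (space Q)"
    by (intro measure_completion_AE_eq) auto
  then show ?thesis using equal hitting_cdf_0[OF s] by (simp add: prob_space)
qed

section \<open>White noise on square integrable functions\<close>

lemma partial_deriv_lincomb:
  assumes "f differentiable (at p)" "g differentiable (at p)"
  shows "partial_deriv e (\<lambda>p. a * f p + b * g p) p = a * partial_deriv e f p + b * partial_deriv e g p"
proof -
  have "((\<lambda>p. a * f p + b * g p) has_derivative
      (\<lambda>h. a * frechet_derivative f (at p) h + b * frechet_derivative g (at p) h)) (at p)"
    using assms unfolding frechet_derivative_works by (intro derivative_intros)
  then show ?thesis unfolding partial_deriv_def by (simp flip: frechet_derivative_at)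
qed

lemma schwartz_iter_partial_lincomb:
  assumes "f \<in> schwartz" "g \<in> schwartz" "es \<in> lists Basis"
  shows "iter_partial es (\<lambda>p. a * f p + b * g p) = (\<lambda>p. a * iter_partial es f p + b * iter_partial es g p)"
  using assms(3)
proof (induction es)
  case Nil
  then show ?case by (simp add: iter_partial_def)
next
  case (Cons e es)
  have "iter_partial es f differentiable (at p)" "iter_partial es g differentiable (at p)" for p
    using assms(1,2) Cons by (auto simp: schwartz_def differentiable_on_def)
  then have "partial_deriv e (\<lambda>p. a * iter_partial es f p + b * iter_partial es g p) =
      (\<lambda>p. a * partial_deriv e (iter_partial es f) p + b * partial_deriv e (iter_partial es g) p)"
    by (intro ext partial_deriv_lincomb)
  then show ?case using Cons by (simp add: iter_partial_def)
qed

lemma schwartz_lincomb: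
  assumes f: "f \<in> schwartz" and g: "g \<in> schwartz"
  shows "(\<lambda>p. a * f p + b * g p) \<in> schwartz"
  unfolding schwartz_def
proof (intro CollectI ballI conjI allI)
  fix es :: "'a list" and k :: nat assume es: "es \<in> lists Basis"
  let ?F = "iter_partial es f" and ?G = "iter_partial es g"
  note eq = schwartz_iter_partial_lincomb[OF f g es, of a b]
  have "?F differentiable_on UNIV" "?G differentiable_on UNIV"
    using f g es by (auto simp: schwartz_def)
  then show "iter_partial es (\<lambda>p. a * f p + b * g p) differentiable_on UNIV"
    unfolding eq by (intro derivative_intros)
  have "bounded (range (\<lambda>p. (1 + norm p) ^ k * ?F p))" "bounded (range (\<lambda>p. (1 + norm p) ^ k * ?G p))"
    using f g es by (auto simp: schwartz_def)
  then obtain A B where AB: "\<And>p. norm ((1 + norm p) ^ k * ?F p) \<le> A" "\<And>p. norm ((1 + norm p) ^ k * ?G p) \<le> B"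
    unfolding bounded_iff by auto
  show "bounded (range (\<lambda>p. (1 + norm p) ^ k * iter_partial es (\<lambda>p. a * f p + b * g p) p))"
    unfolding eq
  proof (rule boundedI, safe)
    fix p
    have "norm (a * ((1 + norm p) ^ k * ?F p) + b * ((1 + norm p) ^ k * ?G p)) \<le>
        norm (a * ((1 + norm p) ^ k * ?F p)) + norm (b * ((1 + norm p) ^ k * ?G p))"
      by (rule norm_triangle_ineq)
    also have "\<dots> \<le> \<bar>a\<bar> * A + \<bar>b\<bar> * B"
      unfolding norm_mult[of a] norm_mult[of b] real_norm_def[of a] real_norm_def[of b]
      by (intro add_mono mult_left_mono AB) auto
    finally show "norm ((1 + norm p) ^ k * (a * ?F p + b * ?G p)) \<le> \<bar>a\<bar> * A + \<bar>b\<bar> * B"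
      by (simp add: algebra_simps)
  qed
qed

lemma zero_in_schwartz: "(\<lambda>p :: 'a :: euclidean_space. 0) \<in> schwartz"
proof -
  have eq: "iter_partial es (\<lambda>p. 0 :: real) = (\<lambda>p. 0)" for es :: "'a list"
    by (induction es) (simp_all add: iter_partial_def partial_deriv_def)
  show ?thesis by (auto simp: schwartz_def eq)
qed

lemma schwartz_borel_measurable: "f \<in> schwartz \<Longrightarrow> f \<in> borel_measurable borel"
proof -
  assume "f \<in> schwartz"
  then have "iter_partial [] f differentiable_on UNIV" unfolding schwartz_def by blast
  then show ?thesis
    by (intro borel_measurable_continuous_onI differentiable_imp_continuous_on) (simp add: iter_partial_def)
qed

lemma D_borel [measurable]: "D \<in> sets borel"
  unfolding D_def by (intro borel_closed closed_Times) auto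

lemma square_integrable_lincomb:
  assumes "square_integrable M f" "square_integrable M g"
  shows "square_integrable M (\<lambda>x. a * f x + b * g x)"
  unfolding square_integrable_def
proof
  have [measurable]: "f \<in> borel_measurable M" "g \<in> borel_measurable M"
    and int: "integrable M (\<lambda>x. (f x)\<^sup>2)" "integrable M (\<lambda>x. (g x)\<^sup>2)"
    using assms by (auto simp: square_integrable_def)
  show "(\<lambda>x. a * f x + b * g x) \<in> borel_measurable M" by measurable
  have "integrable M (\<lambda>x. 2 * a\<^sup>2 * (f x)\<^sup>2 + 2 * b\<^sup>2 * (g x)\<^sup>2)" using int by simp
  then show "integrable M (\<lambda>x. (a * f x + b * g x)\<^sup>2)"
  proof (rule Bochner_Integration.integrable_bound)
    have "(u + v)\<^sup>2 \<le> 2 * u\<^sup>2 + 2 * v\<^sup>2" for u v :: real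
      using sum_squares_bound[of u v] by (simp add: power2_sum)
    then have "norm ((u + v)\<^sup>2) \<le> norm (2 * u\<^sup>2 + 2 * v\<^sup>2)" for u v :: real
      by (simp add: abs_of_nonneg)
    from this[of "a * f x" "b * g x" for x]
    show "AE x in M. norm ((a * f x + b * g x)\<^sup>2) \<le> norm (2 * a\<^sup>2 * (f x)\<^sup>2 + 2 * b\<^sup>2 * (g x)\<^sup>2)"
      by (intro AE_I2) (simp add: power_mult_distrib mult.assoc)
  qed measurable
qed

lemma square_integrable_mult:
  assumes "square_integrable M f" "square_integrable M g"
  shows "integrable M (\<lambda>x. f x * g x)"
proof (rule Bochner_Integration.integrable_bound)
  show "integrable M (\<lambda>x. (f x)\<^sup>2 + (g x)\<^sup>2)"
    using assms by (auto simp: square_integrable_def)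
  have "\<bar>u * v\<bar> \<le> \<bar>u\<^sup>2 + v\<^sup>2\<bar>" for u v :: real
  proof -
    have "2 * \<bar>u * v\<bar> \<le> u\<^sup>2 + v\<^sup>2"
      using sum_squares_bound[of "\<bar>u\<bar>" "\<bar>v\<bar>"] by (simp add: abs_mult)
    then show ?thesis by linarith
  qed
  then show "AE x in M. norm (f x * g x) \<le> norm ((f x)\<^sup>2 + (g x)\<^sup>2)" by auto
qed (use assms in \<open>auto simp: square_integrable_def\<close>)

lemma nn_integral_square_lincomb_tendsto_0:
  fixes F G :: "nat \<Rightarrow> 'a \<Rightarrow> real"
  assumes [measurable]: "\<And>n. F n \<in> borel_measurable M" "\<And>n. G n \<in> borel_measurable M"
    and F: "(\<lambda>n. \<integral>\<^sup>+x. ennreal ((F n x)\<^sup>2) \<partial>M) \<longlonglongrightarrow> 0" and G: "(\<lambda>n. \<integral>\<^sup>+x. ennreal ((G n x)\<^sup>2) \<partial>M) \<longlonglongrightarrow> 0"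
  shows "(\<lambda>n. \<integral>\<^sup>+x. ennreal ((a * F n x + b * G n x)\<^sup>2) \<partial>M) \<longlonglongrightarrow> 0"
proof (rule tendsto_sandwich[OF _ _ tendsto_const])
  let ?R = "\<lambda>n. ennreal (2 * a\<^sup>2) * (\<integral>\<^sup>+x. ennreal ((F n x)\<^sup>2) \<partial>M) + ennreal (2 * b\<^sup>2) * (\<integral>\<^sup>+x. ennreal ((G n x)\<^sup>2) \<partial>M)"
  have "?R \<longlonglongrightarrow> ennreal (2 * a\<^sup>2) * 0 + ennreal (2 * b\<^sup>2) * 0"
    by (intro tendsto_add tendsto_mult_ennreal tendsto_const F G) auto
  then show "?R \<longlonglongrightarrow> 0" by simp
  have *: "(a * u + b * v)\<^sup>2 \<le> 2 * a\<^sup>2 * u\<^sup>2 + 2 * b\<^sup>2 * v\<^sup>2" for u v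
    using sum_squares_bound[of "a * u" "b * v"] by (simp add: power2_sum power_mult_distrib)
  have "(\<integral>\<^sup>+x. ennreal ((a * F n x + b * G n x)\<^sup>2) \<partial>M) \<le> ?R n" for n
  proof -
    have "(\<integral>\<^sup>+x. ennreal ((a * F n x + b * G n x)\<^sup>2) \<partial>M) \<le>
        (\<integral>\<^sup>+x. ennreal (2 * a\<^sup>2) * ennreal ((F n x)\<^sup>2) + ennreal (2 * b\<^sup>2) * ennreal ((G n x)\<^sup>2) \<partial>M)"
      using * by (intro nn_integral_mono) (simp flip: ennreal_mult ennreal_plus add: ennreal_leI)
    also have "\<dots> = ?R n" by (simp add: nn_integral_add nn_integral_cmult)
    finally show ?thesis .
  qed
  then show "\<forall>\<^sub>F n in sequentially. (\<integral>\<^sup>+x. ennreal ((a * F n x + b * G n x)\<^sup>2) \<partial>M) \<le> ?R n" by simp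
qed simp

text \<open>
  Convergence in \<open>L\<^sup>2\<close> implies convergence of the norms; in place of the triangle inequality for the
  norm, the pointwise bound \<open>2 \<bar>w v\<bar> \<le> d v\<^sup>2 + w\<^sup>2 / d\<close> is integrated, for a small \<open>d\<close>.
\<close>

lemma integral_square_tendsto:
  fixes f :: "'a \<Rightarrow> real" and \<Phi> :: "nat \<Rightarrow> 'a \<Rightarrow> real"
  assumes f: "square_integrable M f" and [measurable]: "\<And>n. \<Phi> n \<in> borel_measurable M"
    and lim: "(\<lambda>n. \<integral>\<^sup>+x. ennreal ((\<Phi> n x - f x)\<^sup>2) \<partial>M) \<longlonglongrightarrow> 0"
  shows "(\<lambda>n. integral\<^sup>L M (\<lambda>x. (\<Phi> n x)\<^sup>2)) \<longlonglongrightarrow> integral\<^sup>L M (\<lambda>x. (f x)\<^sup>2)"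
proof (rule tendstoI)
  fix e :: real assume e: "e > 0"
  have [measurable]: "f \<in> borel_measurable M" and intf: "integrable M (\<lambda>x. (f x)\<^sup>2)"
    using f by (auto simp: square_integrable_def)
  define I where "I = integral\<^sup>L M (\<lambda>x. (f x)\<^sup>2)"
  have I: "0 \<le> I" unfolding I_def by (rule Bochner_Integration.integral_nonneg) simp
  \<comment> \<open>The summand 1 covers the case that \<open>f\<close> vanishes almost everywhere.\<close>
  define d where "d = e / (2 * (I + 1))"
  have d: "d > 0" and dI: "d * I < e / 2" using e I by (auto simp: d_def field_simps)
  define C where "C = 1 + 1 / d"
  have C: "C > 0" using d by (simp add: C_def add_pos_pos)
  have "\<forall>\<^sub>F n in sequentially. (\<integral>\<^sup>+x. ennreal ((\<Phi> n x - f x)\<^sup>2) \<partial>M) < ennreal (e / (2 * C))"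
    using lim e C by (intro order_tendstoD(2)) (auto simp: ennreal_zero_less_divide)
  then show "\<forall>\<^sub>F n in sequentially. dist (integral\<^sup>L M (\<lambda>x. (\<Phi> n x)\<^sup>2)) (integral\<^sup>L M (\<lambda>x. (f x)\<^sup>2)) < e"
  proof eventually_elim
    case (elim n)
    let ?X = "\<lambda>x. \<Phi> n x - f x"
    have intX: "integrable M (\<lambda>x. (?X x)\<^sup>2)"
      using less_trans[OF elim ennreal_less_top] by (intro integrableI_bounded) auto
    have "ennreal (integral\<^sup>L M (\<lambda>x. (?X x)\<^sup>2)) < ennreal (e / (2 * C))"
      using elim by (subst nn_integral_eq_integral[symmetric, OF intX]) auto
    then have J: "integral\<^sup>L M (\<lambda>x. (?X x)\<^sup>2) < e / (2 * C)"
      using e C by (subst (asm) ennreal_less_iff) auto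
    have sqX: "square_integrable M ?X" using intX by (simp add: square_integrable_def)
    have "square_integrable M (\<lambda>x. 1 * ?X x + 1 * f x)" by (rule square_integrable_lincomb[OF sqX f])
    then have intP: "integrable M (\<lambda>x. (\<Phi> n x)\<^sup>2)" by (simp add: square_integrable_def)
    have bound: "\<bar>u\<^sup>2 - v\<^sup>2\<bar> \<le> C * (u - v)\<^sup>2 + d * v\<^sup>2" for u v :: real
    proof -
      have young: "2 * (w * v) \<le> d * v\<^sup>2 + w\<^sup>2 / d" for w
      proof -
        have "0 \<le> d * (v - w / d)\<^sup>2" using d by simp
        also have "\<dots> = d * v\<^sup>2 - 2 * (w * v) + w\<^sup>2 / d"
          using d by (simp add: power2_eq_square field_simps)
        finally show ?thesis by simp
      qed
      have "2 * ((u - v) * v) \<le> d * v\<^sup>2 + (u - v)\<^sup>2 / d" "- (2 * ((u - v) * v)) \<le> d * v\<^sup>2 + (u - v)\<^sup>2 / d"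
        using young[of "u - v"] young[of "- (u - v)"] by (simp_all only: mult_minus_left mult_minus_right power2_minus)
      moreover have "u\<^sup>2 - v\<^sup>2 = (u - v)\<^sup>2 + 2 * ((u - v) * v)" by (simp add: power2_eq_square algebra_simps)
      moreover have "C * (u - v)\<^sup>2 = (u - v)\<^sup>2 + (u - v)\<^sup>2 / d" by (simp add: C_def algebra_simps)
      moreover have "0 \<le> (u - v)\<^sup>2" by simp
      ultimately show ?thesis by linarith
    qed
    have "\<bar>integral\<^sup>L M (\<lambda>x. (\<Phi> n x)\<^sup>2) - I\<bar> = \<bar>integral\<^sup>L M (\<lambda>x. (\<Phi> n x)\<^sup>2 - (f x)\<^sup>2)\<bar>"
      unfolding I_def using intP intf by simp
    also have "\<dots> \<le> integral\<^sup>L M (\<lambda>x. \<bar>(\<Phi> n x)\<^sup>2 - (f x)\<^sup>2\<bar>)" by (rule integral_abs_bound)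
    also have "\<dots> \<le> integral\<^sup>L M (\<lambda>x. C * (?X x)\<^sup>2 + d * (f x)\<^sup>2)"
      using intP intf intX by (intro Bochner_Integration.integral_mono bound) auto
    also have "\<dots> = C * integral\<^sup>L M (\<lambda>x. (?X x)\<^sup>2) + d * I" using intX intf by (simp add: I_def)
    also have "\<dots> < C * (e / (2 * C)) + e / 2"
      using J C dI by (intro add_strict_mono mult_strict_left_mono)
    also have "\<dots> = e" using C by simp
    finally show ?case by (simp add: dist_real_def I_def)
  qed
qed

text \<open>
  Integrate \<open>\<bar>iexp u - iexp v\<bar> \<le> \<bar>u - v\<bar> \<le> d + (u - v)\<^sup>2 / d\<close> for a small \<open>d\<close>.
\<close>

lemma (in prob_space) char_L2_tendsto:
  assumes [measurable]: "\<And>n. F n \<in> borel_measurable M" "Y \<in> borel_measurable M"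
    and lim: "(\<lambda>n. \<integral>\<^sup>+\<omega>. ennreal ((F n \<omega> - Y \<omega>)\<^sup>2) \<partial>M) \<longlonglongrightarrow> 0"
  shows "(\<lambda>n. CLINT \<omega>|M. iexp (F n \<omega>)) \<longlonglongrightarrow> (CLINT \<omega>|M. iexp (Y \<omega>))"
proof (rule tendstoI)
  fix e :: real assume e: "e > 0"
  define d where "d = e / 2"
  have d: "d > 0" using e by (simp add: d_def)
  have "\<forall>\<^sub>F n in sequentially. (\<integral>\<^sup>+\<omega>. ennreal ((F n \<omega> - Y \<omega>)\<^sup>2) \<partial>M) < ennreal (d * d)"
    using lim d by (intro order_tendstoD(2)) auto
  then show "\<forall>\<^sub>F n in sequentially. dist (CLINT \<omega>|M. iexp (F n \<omega>)) (CLINT \<omega>|M. iexp (Y \<omega>)) < e"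
  proof eventually_elim
    case (elim n)
    let ?X = "\<lambda>\<omega>. F n \<omega> - Y \<omega>"
    have intX: "integrable M (\<lambda>\<omega>. (?X \<omega>)\<^sup>2)"
      using less_trans[OF elim ennreal_less_top] by (intro integrableI_bounded) auto
    have "ennreal (expectation (\<lambda>\<omega>. (?X \<omega>)\<^sup>2)) < ennreal (d * d)"
      using elim by (subst nn_integral_eq_integral[symmetric, OF intX]) auto
    then have J: "expectation (\<lambda>\<omega>. (?X \<omega>)\<^sup>2) < d * d"
      using d by (subst (asm) ennreal_less_iff) auto
    have int: "complex_integrable M (\<lambda>\<omega>. iexp (F n \<omega>))" "complex_integrable M (\<lambda>\<omega>. iexp (Y \<omega>))"
      by (auto intro!: integrable_iexp)
    have bound: "norm (iexp u - iexp v) \<le> d + (u - v)\<^sup>2 / d" for u v :: real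
    proof -
      have "iexp u - iexp v = iexp v * (iexp (u - v) - 1)"
        by (simp add: algebra_simps flip: exp_add)
      then have "norm (iexp u - iexp v) = norm (iexp (u - v) - 1)"
        by (simp add: norm_mult del: of_real_diff)
      also have "\<dots> \<le> \<bar>u - v\<bar>"
        using iexp_approx1[of "u - v" 0] by simp
      also have "\<dots> \<le> d + (u - v)\<^sup>2 / d"
      proof -
        have "2 * (\<bar>u - v\<bar> * d) \<le> (u - v)\<^sup>2 + d * d"
          using sum_squares_bound[of "\<bar>u - v\<bar>" d] by (simp add: mult.assoc flip: power2_eq_square)
        moreover have "0 \<le> \<bar>u - v\<bar> * d" using d by simp
        ultimately have "\<bar>u - v\<bar> * d \<le> d * d + (u - v)\<^sup>2" by linarith
        then show ?thesis using d by (simp add: field_simps)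
      qed
      finally show ?thesis .
    qed
    have "dist (CLINT \<omega>|M. iexp (F n \<omega>)) (CLINT \<omega>|M. iexp (Y \<omega>)) = norm (CLINT \<omega>|M. iexp (F n \<omega>) - iexp (Y \<omega>))"
      using int by (simp add: dist_norm)
    also have "\<dots> \<le> expectation (\<lambda>\<omega>. norm (iexp (F n \<omega>) - iexp (Y \<omega>)))" by (rule integral_norm_bound)
    also have "\<dots> \<le> expectation (\<lambda>\<omega>. d + (?X \<omega>)\<^sup>2 / d)"
      using int intX by (intro Bochner_Integration.integral_mono bound) auto
    also have "\<dots> = d + expectation (\<lambda>\<omega>. (?X \<omega>)\<^sup>2) / d" using intX by (simp add: prob_space)
    also have "\<dots> < d + d" using J d by (simp add: divide_less_eq)
    finally show ?case by (simp add: d_def)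
  qed
qed

lemma space_white_noise: "white_noise_measure P \<Longrightarrow> space P = dual_D"
proof -
  assume "white_noise_measure P"
  then have "space P = space weak_star_borel"
    by (intro sets_eq_imp_space_eq) (simp add: white_noise_measure_def)
  then show ?thesis by (simp add: weak_star_borel_def space_measure_of_conv)
qed

lemma white_noise_lincomb:
  assumes "\<omega> \<in> dual_D" "\<phi> \<in> schwartz" "\<psi> \<in> schwartz"
  shows "white_noise \<omega> (\<lambda>p. a * \<phi> p + b * \<psi> p) = a * white_noise \<omega> \<phi> + b * white_noise \<omega> \<psi>"
proof -
  have "restrict_D (\<lambda>p. a * \<phi> p + b * \<psi> p) = (\<lambda>p. a * restrict_D \<phi> p + b * restrict_D \<psi> p)"
    by (auto simp: restrict_D_def)
  moreover have "restrict_D \<phi> \<in> schwartz_D" "restrict_D \<psi> \<in> schwartz_D"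
    using assms by (auto simp: schwartz_D_def)
  ultimately show ?thesis using assms(1) by (simp add: white_noise_def dual_D_def)
qed

text \<open>Evaluation at a test function is continuous for the topology of pointwise convergence.\<close>

lemma white_noise_measurable:
  assumes P: "white_noise_measure P" and \<phi>: "\<phi> \<in> schwartz"
  shows "(\<lambda>\<omega>. white_noise \<omega> \<phi>) \<in> borel_measurable P"
proof (rule borel_measurableI)
  fix S :: "real set" assume S: "open S"
  let ?T = "product_topology (\<lambda>_. euclideanreal) schwartz_D"
  have \<phi>': "restrict_D \<phi> \<in> schwartz_D" using \<phi> by (auto simp: schwartz_D_def)
  have "openin ?T {\<omega> \<in> topspace ?T. \<omega> (restrict_D \<phi>) \<in> S}"
    by (rule openin_continuous_map_preimage[OF continuous_map_product_projection[OF \<phi>']]) (use S in auto)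
  then have "openin weak_star_topology ({\<omega> \<in> topspace ?T. \<omega> (restrict_D \<phi>) \<in> S} \<inter> dual_D)"
    unfolding weak_star_topology_def by (auto simp: openin_subtopology)
  moreover have "{\<omega> \<in> topspace ?T. \<omega> (restrict_D \<phi>) \<in> S} \<inter> dual_D = (\<lambda>\<omega>. white_noise \<omega> \<phi>) -` S \<inter> space P"
    unfolding space_white_noise[OF P] by (auto simp: white_noise_def dual_D_def PiE_def)
  moreover have "{U. openin weak_star_topology U} \<subseteq> Pow dual_D"
    using openin_subset by (fastforce simp: weak_star_topology_def)
  ultimately have "(\<lambda>\<omega>. white_noise \<omega> \<phi>) -` S \<inter> space P \<in> sets weak_star_borel"
    unfolding weak_star_borel_def by (simp add: sigma_sets.Basic)
  then show "(\<lambda>\<omega>. white_noise \<omega> \<phi>) -` S \<inter> space P \<in> sets P"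
    using P by (simp add: white_noise_measure_def)
qed

lemma white_noise_pairing_lincomb:
  assumes P: "white_noise_measure P"
    and f: "white_noise_pairing P f Y" and g: "white_noise_pairing P g Z"
  shows "white_noise_pairing P (\<lambda>p. a * f p + b * g p) (\<lambda>\<omega>. a * Y \<omega> + b * Z \<omega>)"
proof -
  obtain \<phi> where \<phi>: "\<And>n. \<phi> n \<in> schwartz"
    "(\<lambda>n. \<integral>\<^sup>+p\<in>D. ennreal ((\<phi> n p - f p)\<^sup>2) \<partial>lborel) \<longlonglongrightarrow> 0"
    "(\<lambda>n. \<integral>\<^sup>+\<omega>. ennreal ((white_noise \<omega> (\<phi> n) - Y \<omega>)\<^sup>2) \<partial>completion P) \<longlonglongrightarrow> 0"
    using f unfolding white_noise_pairing_def by blast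
  obtain \<psi> where \<psi>: "\<And>n. \<psi> n \<in> schwartz"
    "(\<lambda>n. \<integral>\<^sup>+p\<in>D. ennreal ((\<psi> n p - g p)\<^sup>2) \<partial>lborel) \<longlonglongrightarrow> 0"
    "(\<lambda>n. \<integral>\<^sup>+\<omega>. ennreal ((white_noise \<omega> (\<psi> n) - Z \<omega>)\<^sup>2) \<partial>completion P) \<longlonglongrightarrow> 0"
    using g unfolding white_noise_pairing_def by blast
  have sq: "square_integrable lborel f" "square_integrable lborel g"
    "square_integrable (completion P) Y" "square_integrable (completion P) Z"
    using f g by (auto simp: white_noise_pairing_def)
  then have [measurable]: "f \<in> borel_measurable borel" "g \<in> borel_measurable borel"
    "Y \<in> borel_measurable (completion P)" "Z \<in> borel_measurable (completion P)"
    by (auto simp: square_integrable_def)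
  have [measurable]: "\<phi> n \<in> borel_measurable borel" "\<psi> n \<in> borel_measurable borel" for n
    using \<phi>(1) \<psi>(1) by (auto intro: schwartz_borel_measurable)
  have [measurable]: "(\<lambda>\<omega>. white_noise \<omega> (\<phi> n)) \<in> borel_measurable (completion P)"
    "(\<lambda>\<omega>. white_noise \<omega> (\<psi> n)) \<in> borel_measurable (completion P)" for n
    using \<phi>(1) \<psi>(1) by (auto intro: measurable_completion white_noise_measurable[OF P])
  have ind: "ennreal (z\<^sup>2) * indicator D p = ennreal ((z * indicator D p)\<^sup>2)" for z p
    by (auto simp: indicator_def)
  let ?\<xi> = "\<lambda>n p. a * \<phi> n p + b * \<psi> n p"
  have "(\<lambda>n. \<integral>\<^sup>+p. ennreal ((a * ((\<phi> n p - f p) * indicator D p) + b * ((\<psi> n p - g p) * indicator D p))\<^sup>2) \<partial>lborel) \<longlonglongrightarrow> 0"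
    using \<phi>(2) \<psi>(2) unfolding ind by (intro nn_integral_square_lincomb_tendsto_0) auto
  moreover have "a * ((\<phi> n p - f p) * indicator D p) + b * ((\<psi> n p - g p) * indicator D p) =
      (?\<xi> n p - (a * f p + b * g p)) * indicator D p" for n p
    by (simp add: algebra_simps)
  ultimately have 1: "(\<lambda>n. \<integral>\<^sup>+p\<in>D. ennreal ((?\<xi> n p - (a * f p + b * g p))\<^sup>2) \<partial>lborel) \<longlonglongrightarrow> 0"
    unfolding ind by simp
  have "(\<lambda>n. \<integral>\<^sup>+\<omega>. ennreal ((a * (white_noise \<omega> (\<phi> n) - Y \<omega>) + b * (white_noise \<omega> (\<psi> n) - Z \<omega>))\<^sup>2) \<partial>completion P) \<longlonglongrightarrow> 0"
    using \<phi>(3) \<psi>(3) by (intro nn_integral_square_lincomb_tendsto_0) auto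
  moreover have "(\<integral>\<^sup>+\<omega>. ennreal ((a * (white_noise \<omega> (\<phi> n) - Y \<omega>) + b * (white_noise \<omega> (\<psi> n) - Z \<omega>))\<^sup>2) \<partial>completion P) =
      (\<integral>\<^sup>+\<omega>. ennreal ((white_noise \<omega> (?\<xi> n) - (a * Y \<omega> + b * Z \<omega>))\<^sup>2) \<partial>completion P)" for n
    using \<phi>(1) \<psi>(1)
    by (intro nn_integral_cong) (simp add: white_noise_lincomb space_white_noise[OF P] algebra_simps)
  ultimately have 2: "(\<lambda>n. \<integral>\<^sup>+\<omega>. ennreal ((white_noise \<omega> (?\<xi> n) - (a * Y \<omega> + b * Z \<omega>))\<^sup>2) \<partial>completion P) \<longlonglongrightarrow> 0"
    by simp
  show ?thesis
    unfolding white_noise_pairing_def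
    using square_integrable_lincomb[OF sq(1,2)] square_integrable_lincomb[OF sq(3,4)]
      schwartz_lincomb[OF \<phi>(1) \<psi>(1)] 1 2
    by (intro conjI exI[of _ ?\<xi>]) auto
qed

lemma white_noise_pairing_zero:
  assumes P: "white_noise_measure P"
  shows "white_noise_pairing P (\<lambda>p. 0) (\<lambda>\<omega>. 0)"
proof -
  have "white_noise \<omega> (\<lambda>p. 0) = 0" if "\<omega> \<in> dual_D" for \<omega>
    using white_noise_lincomb[OF that zero_in_schwartz zero_in_schwartz, of 0 0] by simp
  then have "(\<integral>\<^sup>+\<omega>. ennreal ((white_noise \<omega> (\<lambda>p. 0) - 0)\<^sup>2) \<partial>completion P) = (\<integral>\<^sup>+\<omega>. 0 \<partial>completion P)"
    by (intro nn_integral_cong) (simp add: space_white_noise[OF P])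
  then show ?thesis
    unfolding white_noise_pairing_def
    by (intro conjI exI[of _ "\<lambda>_ _. 0"]) (auto simp: square_integrable_def zero_in_schwartz)
qed

lemma white_noise_pairing_sum:
  assumes P: "white_noise_measure P" and I: "finite I"
    and Y: "\<And>i. i \<in> I \<Longrightarrow> white_noise_pairing P (h i) (Y i)"
  shows "white_noise_pairing P (\<lambda>p. \<Sum>i\<in>I. t i * h i p) (\<lambda>\<omega>. \<Sum>i\<in>I. t i * Y i \<omega>)"
  using I Y
proof (induction I rule: finite_induct)
  case empty
  then show ?case using white_noise_pairing_zero[OF P] by simp
next
  case (insert i I)
  have "white_noise_pairing P (\<lambda>p. t i * h i p + 1 * (\<Sum>i\<in>I. t i * h i p)) (\<lambda>\<omega>. t i * Y i \<omega> + 1 * (\<Sum>i\<in>I. t i * Y i \<omega>))"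
    by (rule white_noise_pairing_lincomb[OF P]) (use insert in auto)
  then show ?case using insert.hyps by simp
qed

lemma prob_space_completion: "prob_space P \<Longrightarrow> prob_space (completion P)"
  by (intro prob_spaceI) (simp add: prob_space.emeasure_space_1)

text \<open>
  Both sides of the defining identity of the white noise measure are continuous under the mean square
  limits that define the pairing.
\<close>

lemma white_noise_pairing_char:
  assumes P: "white_noise_measure P" and f: "white_noise_pairing P f Y"
  shows "(CLINT \<omega>|completion P. iexp (Y \<omega>)) = of_real (exp (- (1/2) * (LINT p:D|lborel. (f p)\<^sup>2)))"
proof -
  have "prob_space P" using P by (simp add: white_noise_measure_def)
  then interpret prob_space "completion P" by (rule prob_space_completion)
  obtain \<phi> where \<phi>: "\<And>n. \<phi> n \<in> schwartz"
    "(\<lambda>n. \<integral>\<^sup>+p\<in>D. ennreal ((\<phi> n p - f p)\<^sup>2) \<partial>lborel) \<longlonglongrightarrow> 0"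
    "(\<lambda>n. \<integral>\<^sup>+\<omega>. ennreal ((white_noise \<omega> (\<phi> n) - Y \<omega>)\<^sup>2) \<partial>completion P) \<longlonglongrightarrow> 0"
    using f unfolding white_noise_pairing_def by blast
  have sq: "square_integrable lborel f" "square_integrable (completion P) Y"
    using f by (auto simp: white_noise_pairing_def)
  then have [measurable]: "f \<in> borel_measurable borel" "Y \<in> borel_measurable (completion P)"
    by (auto simp: square_integrable_def)
  have [measurable]: "\<phi> n \<in> borel_measurable borel" for n
    using \<phi>(1) by (auto intro: schwartz_borel_measurable)
  have wn[measurable]: "(\<lambda>\<omega>. white_noise \<omega> (\<phi> n)) \<in> borel_measurable P" for n
    using \<phi>(1) by (rule white_noise_measurable[OF P])
  have "(\<lambda>n. CLINT \<omega>|completion P. iexp (white_noise \<omega> (\<phi> n))) \<longlonglongrightarrow> (CLINT \<omega>|completion P. iexp (Y \<omega>))"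
    by (rule char_L2_tendsto[OF _ _ \<phi>(3)]) (auto intro: measurable_completion)
  moreover have "(CLINT \<omega>|completion P. iexp (white_noise \<omega> (\<phi> n))) =
      of_real (exp (- (1/2) * (LINT p|lborel. (\<phi> n p * indicator D p)\<^sup>2)))" for n
  proof -
    have "(CLINT \<omega>|completion P. iexp (white_noise \<omega> (\<phi> n))) = (CLINT \<omega>|P. iexp (white_noise \<omega> (\<phi> n)))"
      by (rule integral_completion) measurable
    also have "\<dots> = of_real (exp (- (1/2) * (LINT p:D|lborel. (restrict_D (\<phi> n) p)\<^sup>2)))"
      using P \<phi>(1) unfolding white_noise_measure_def white_noise_def schwartz_D_def by blast
    also have "(LINT p:D|lborel. (restrict_D (\<phi> n) p)\<^sup>2) = (LINT p|lborel. (\<phi> n p * indicator D p)\<^sup>2)"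
      unfolding set_lebesgue_integral_def
      by (intro Bochner_Integration.integral_cong) (auto simp: restrict_D_def indicator_def)
    finally show ?thesis .
  qed
  moreover have "(\<lambda>n. LINT p|lborel. (\<phi> n p * indicator D p)\<^sup>2) \<longlonglongrightarrow> (LINT p|lborel. (f p * indicator D p)\<^sup>2)"
  proof (rule integral_square_tendsto)
    have "integrable lborel (\<lambda>p. (f p)\<^sup>2 * indicator D p)"
      using sq(1) by (intro integrable_real_mult_indicator) (auto simp: square_integrable_def)
    moreover have "(f p)\<^sup>2 * indicator D p = (f p * indicator D p)\<^sup>2" for p by (auto simp: indicator_def)
    ultimately show "square_integrable lborel (\<lambda>p. f p * indicator D p)"
      by (simp add: square_integrable_def)
    have "ennreal ((\<phi> n p * indicator D p - f p * indicator D p)\<^sup>2) = ennreal ((\<phi> n p - f p)\<^sup>2) * indicator D p" for n p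
      by (auto simp: indicator_def)
    then show "(\<lambda>n. \<integral>\<^sup>+p. ennreal ((\<phi> n p * indicator D p - f p * indicator D p)\<^sup>2) \<partial>lborel) \<longlonglongrightarrow> 0"
      using \<phi>(2) by simp
  qed measurable
  then have "(\<lambda>n. complex_of_real (exp (- (1/2) * (LINT p|lborel. (\<phi> n p * indicator D p)\<^sup>2)))) \<longlonglongrightarrow>
      of_real (exp (- (1/2) * (LINT p|lborel. (f p * indicator D p)\<^sup>2)))"
    by (intro tendsto_intros)
  ultimately have "(CLINT \<omega>|completion P. iexp (Y \<omega>)) = of_real (exp (- (1/2) * (LINT p|lborel. (f p * indicator D p)\<^sup>2)))"
    using LIMSEQ_unique by simp
  also have "(LINT p|lborel. (f p * indicator D p)\<^sup>2) = (LINT p:D|lborel. (f p)\<^sup>2)"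
    unfolding set_lebesgue_integral_def by (intro Bochner_Integration.integral_cong) (auto simp: indicator_def)
  finally show ?thesis .
qed

text \<open>
  Multiples \<open>s * Y\<close> are again values of the pairing, so the characteristic functional determines the
  characteristic function of \<open>Y\<close>.
\<close>

lemma white_noise_pairing_normal:
  assumes P: "white_noise_measure P" and f: "white_noise_pairing P f Y"
    and v: "(LINT p:D|lborel. (f p)\<^sup>2) = v" "v > 0"
  shows "distributed (completion P) lborel Y (normal_density 0 (sqrt v))"
proof -
  have "prob_space P" using P by (simp add: white_noise_measure_def)
  then interpret prob_space "completion P" by (rule prob_space_completion)
  have Y[measurable]: "Y \<in> borel_measurable (completion P)"
    using f by (auto simp: white_noise_pairing_def square_integrable_def)
  let ?Z = "\<lambda>\<omega>. (Y \<omega> - 0) / sqrt v"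
  have "distr (completion P) borel ?Z = std_normal_distribution"
  proof (rule Levy_uniqueness)
    show "real_distribution (distr (completion P) borel ?Z)" by (rule real_distribution_distr) measurable
    show "char (distr (completion P) borel ?Z) = char std_normal_distribution"
    proof
      fix s
      have "white_noise_pairing P (\<lambda>p. s / sqrt v * f p + 0 * f p) (\<lambda>\<omega>. s / sqrt v * Y \<omega> + 0 * Y \<omega>)"
        by (rule white_noise_pairing_lincomb[OF P f f])
      from white_noise_pairing_char[OF P this]
      have "(CLINT \<omega>|completion P. iexp (s / sqrt v * Y \<omega>)) = of_real (exp (- (1/2) * (LINT p:D|lborel. (s / sqrt v)\<^sup>2 * (f p)\<^sup>2)))"
        by (simp only: power_mult_distrib mult_zero_left add_0_right)
      also have "(LINT p:D|lborel. (s / sqrt v)\<^sup>2 * (f p)\<^sup>2) = (s / sqrt v)\<^sup>2 * v"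
        unfolding v(1)[symmetric] by (rule set_integral_mult_right)
      also have "\<dots> = s\<^sup>2" using v(2) by (simp add: power_divide)
      finally show "char (distr (completion P) borel ?Z) s = char std_normal_distribution s"
        by (simp add: char_distr char_std_normal_distribution)
    qed
  qed (rule real_dist_normal_dist)
  then have "distr (completion P) lborel ?Z = std_normal_distribution"
    by (metis distr_cong sets_lborel)
  then have "distributed (completion P) lborel ?Z std_normal_density"
    unfolding distributed_def by auto
  then show ?thesis using v(2) by (subst normal_standard_normal_convert) auto
qed

text \<open>
  By orthogonality the squared norm of \<open>\<Sum>i\<in>I. t i * h i\<close> is a sum of contributions of the single \<open>i\<close>, so
  the exponential in the characteristic functional factorises.
\<close>

lemma white_noise_pairing_indep:
  assumes P: "white_noise_measure P" and I: "finite I" "I \<noteq> {}"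
    and Y: "\<And>i. i \<in> I \<Longrightarrow> white_noise_pairing P (h i) (Y i)"
    and orth: "\<And>i j. i \<in> I \<Longrightarrow> j \<in> I \<Longrightarrow> i \<noteq> j \<Longrightarrow> (LINT p:D|lborel. h i p * h j p) = 0"
  shows "prob_space.indep_vars (completion P) (\<lambda>_. borel) Y I"
proof -
  have "prob_space P" using P by (simp add: white_noise_measure_def)
  then interpret prob_space "completion P" by (rule prob_space_completion)
  let ?v = "\<lambda>i. LINT p:D|lborel. (h i p)\<^sup>2"
  have rv: "Y i \<in> borel_measurable (completion P)" if "i \<in> I" for i
    using Y[OF that] by (auto simp: white_noise_pairing_def square_integrable_def)
  have one: "char (distr (completion P) borel (Y i)) s = of_real (exp (- (1/2) * (s\<^sup>2 * ?v i)))" if i: "i \<in> I" for i s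
  proof -
    have "white_noise_pairing P (\<lambda>p. s * h i p + 0 * h i p) (\<lambda>\<omega>. s * Y i \<omega> + 0 * Y i \<omega>)"
      by (rule white_noise_pairing_lincomb[OF P Y Y]) fact+
    from white_noise_pairing_char[OF P this] show ?thesis
      using rv[OF i] by (simp add: char_distr power_mult_distrib)
  qed
  show ?thesis
  proof (rule indep_vars_of_char[OF I rv])
    fix t :: "'a \<Rightarrow> real"
    have int: "set_integrable lborel D (\<lambda>p. t i * h i p * (t j * h j p))" if "i \<in> I" "j \<in> I" for i j
    proof -
      have "integrable lborel (\<lambda>p. h i p * h j p)"
        using Y that by (intro square_integrable_mult) (auto simp: white_noise_pairing_def)
      then have "integrable lborel (\<lambda>p. t i * t j * (h i p * h j p))" by simp
      then have "integrable lborel (\<lambda>p. t i * h i p * (t j * h j p))" by (simp add: mult_ac)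
      then show ?thesis unfolding set_integrable_def by (intro integrable_mult_indicator) auto
    qed
    have "(LINT p:D|lborel. (\<Sum>i\<in>I. t i * h i p)\<^sup>2) = (LINT p:D|lborel. \<Sum>i\<in>I. \<Sum>j\<in>I. t i * h i p * (t j * h j p))"
      by (simp add: power2_eq_square sum_product)
    also have "\<dots> = (\<Sum>i\<in>I. \<Sum>j\<in>I. LINT p:D|lborel. t i * h i p * (t j * h j p))"
      using int unfolding set_lebesgue_integral_def set_integrable_def
      by (simp only: scaleR_sum_right) (simp add: Bochner_Integration.integral_sum)
    also have "\<dots> = (\<Sum>i\<in>I. \<Sum>j\<in>I. if j = i then (t i)\<^sup>2 * ?v i else 0)"
    proof (intro sum.cong refl)
      fix i j assume ij: "i \<in> I" "j \<in> I"
      have "(LINT p:D|lborel. t i * h i p * (t j * h j p)) = (LINT p:D|lborel. (t i * t j) * (h i p * h j p))"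
        by (simp add: mult_ac)
      also have "\<dots> = (t i * t j) * (LINT p:D|lborel. h i p * h j p)" by (rule set_integral_mult_right)
      finally show "(LINT p:D|lborel. t i * h i p * (t j * h j p)) = (if j = i then (t i)\<^sup>2 * ?v i else 0)"
        using orth[OF ij] by (auto simp: power2_eq_square)
    qed
    also have "\<dots> = (\<Sum>i\<in>I. (t i)\<^sup>2 * ?v i)" using I by simp
    finally have norm: "(LINT p:D|lborel. (\<Sum>i\<in>I. t i * h i p)\<^sup>2) = (\<Sum>i\<in>I. (t i)\<^sup>2 * ?v i)" .
    have "(CLINT \<omega>|completion P. iexp (\<Sum>i\<in>I. t i * Y i \<omega>)) = of_real (exp (- (1/2) * (\<Sum>i\<in>I. (t i)\<^sup>2 * ?v i)))"
      using white_noise_pairing_char[OF P white_noise_pairing_sum[OF P I(1) Y, where t=t]] norm by simp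
    also have "\<dots> = (\<Prod>i\<in>I. complex_of_real (exp (- (1/2) * ((t i)\<^sup>2 * ?v i))))"
      unfolding sum_distrib_left exp_sum[OF I(1)] of_real_prod ..
    also have "\<dots> = (\<Prod>i\<in>I. char (distr (completion P) borel (Y i)) (t i))"
      by (intro prod.cong refl one[symmetric])
    finally show "(CLINT \<omega>|completion P. iexp (\<Sum>i\<in>I. t i * Y i \<omega>)) = (\<Prod>i\<in>I. char (distr (completion P) borel (Y i)) (t i))" .
  qed
qed

section \<open>Brownian motion observed during a time interval\<close>

text \<open>
  A Brownian motion that is observed only during the times from \<open>r0\<close> to \<open>r1\<close>, so that it starts with a
  normally distributed value. Independence is required on equidistant grids, the form in which the
  reflection principle uses it; index 0 of a grid stands for the starting value.
\<close>

locale brownian_segment = prob_space M for M :: "'a measure" +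
  fixes W :: "real \<Rightarrow> 'a \<Rightarrow> real" and r0 r1 :: real
  assumes r0: "0 < r0" and r1: "r0 < r1"
    and cont: "AE \<omega> in M. continuous_on {r0..r1} (\<lambda>r. W r \<omega>)"
    and start: "distributed M lborel (W r0) (normal_density 0 (sqrt r0))"
    and incr: "\<And>q r. r0 \<le> q \<Longrightarrow> q < r \<Longrightarrow> r \<le> r1 \<Longrightarrow>
      distributed M lborel (\<lambda>\<omega>. W r \<omega> - W q \<omega>) (normal_density 0 (sqrt (r - q)))"
    and indep: "\<And>n. n > 0 \<Longrightarrow> indep_vars (\<lambda>_. borel)
      (\<lambda>i \<omega>. if i = 0 then W r0 \<omega>
        else W (r0 + (r1 - r0) * (real i / real n)) \<omega> - W (r0 + (r1 - r0) * (real (i - 1) / real n)) \<omega>) {..n}"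
begin

lemma W_start_measurable [measurable]: "W r0 \<in> borel_measurable M"
  using distributed_measurable[OF start] by simp

lemma incr_measurable: "q \<in> {r0..r1} \<Longrightarrow> r \<in> {r0..r1} \<Longrightarrow> q < r \<Longrightarrow> (\<lambda>\<omega>. W r \<omega> - W q \<omega>) \<in> borel_measurable M"
  using distributed_measurable[OF incr[of q r]] by simp

lemma W_measurable:
  assumes "r \<in> {r0..r1}"
  shows "W r \<in> borel_measurable M"
proof (cases "r = r0")
  case False
  then have "(\<lambda>\<omega>. W r \<omega> - W r0 \<omega>) \<in> borel_measurable M"
    using assms r1 by (intro incr_measurable) auto
  then have "(\<lambda>\<omega>. (W r \<omega> - W r0 \<omega>) + W r0 \<omega>) \<in> borel_measurable M" by measurable
  then show ?thesis by simp
qed simp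

lemma brownian_segment_uminus: "brownian_segment M (\<lambda>r \<omega>. - W r \<omega>) r0 r1"
proof unfold_locales
  show "AE \<omega> in M. continuous_on {r0..r1} (\<lambda>r. - W r \<omega>)"
    using cont by eventually_elim (intro continuous_intros)
  show "distributed M lborel (\<lambda>\<omega>. - W r0 \<omega>) (normal_density 0 (sqrt r0))"
    using normal_symmetric[OF start] r0 by simp
  show "distributed M lborel (\<lambda>\<omega>. - W r \<omega> - - W q \<omega>) (normal_density 0 (sqrt (r - q)))"
    if "r0 \<le> q" "q < r" "r \<le> r1" for q r
    using normal_symmetric[OF incr[OF that]] that by simp
  fix n :: nat assume n: "n > 0"
  let ?X = "\<lambda>i \<omega>. if i = 0 then W r0 \<omega>
        else W (r0 + (r1 - r0) * (real i / real n)) \<omega> - W (r0 + (r1 - r0) * (real (i - 1) / real n)) \<omega>"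
  have "indep_vars (\<lambda>_. borel) (\<lambda>i \<omega>. - ?X i \<omega>) {..n}"
    by (rule indep_vars_compose2[OF indep[OF n]]) auto
  also have "(\<lambda>i \<omega>. - ?X i \<omega>) = (\<lambda>i \<omega>. if i = 0 then - W r0 \<omega>
        else - W (r0 + (r1 - r0) * (real i / real n)) \<omega> - - W (r0 + (r1 - r0) * (real (i - 1) / real n)) \<omega>)"
    by (intro ext) simp
  finally show "indep_vars (\<lambda>_. borel) \<dots> {..n}" .
qed (use r0 r1 in auto)

text \<open>
  Fubini for the independent pair of starting value and total increment; the factor 2 turns the normal
  tail into the distribution function of the hitting time.
\<close>

lemma prob_start_below_end_above:
  "2 * prob {\<omega>\<in>space M. W r0 \<omega> \<le> a \<and> W r1 \<omega> > a} =
    (LINT y:{..a}|lborel. hitting_cdf (a - y) (r1 - r0) * normal_density 0 (sqrt r0) y)"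
proof -
  define Z where "Z = (\<lambda>\<omega>. W r1 \<omega> - W r0 \<omega>)"
  have Z: "distributed M lborel Z (normal_density 0 (sqrt (r1 - r0)))"
    unfolding Z_def using r1 by (intro incr) auto
  then have [measurable]: "Z \<in> borel_measurable M" using distributed_measurable[OF Z] by simp
  \<comment> \<open>The grid with a single step consists of the starting value and the total increment.\<close>
  have "indep_vars (\<lambda>_. borel) (\<lambda>i \<omega>. if i = 0 then W r0 \<omega>
        else W (r0 + (r1 - r0) * (real i / real 1)) \<omega> - W (r0 + (r1 - r0) * (real (i - 1) / real 1)) \<omega>) (insert 0 {1})"
    by (rule indep_vars_subset[OF indep[of 1]]) auto
  from indep_vars_sum[OF _ _ this] have ind: "indep_var borel (W r0) borel Z"
    by (simp add: Z_def)
  let ?\<mu> = "distr M borel (W r0)" and ?\<nu> = "distr M borel Z"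
  interpret \<mu>: prob_space ?\<mu> by (rule prob_space_distr) simp
  interpret \<nu>: prob_space ?\<nu> by (rule prob_space_distr) simp
  let ?S = "{z \<in> space (borel \<Otimes>\<^sub>M borel). fst z \<le> a \<and> fst z + snd z > a} :: (real \<times> real) set"
  have S[measurable]: "?S \<in> sets (borel \<Otimes>\<^sub>M borel)" by measurable
  define m where "m = (\<lambda>y. measure ?\<nu> {a - y<..})"
  have "mono m" unfolding m_def by (intro monoI \<nu>.finite_measure_mono) auto
  then have m[measurable]: "m \<in> borel_measurable borel" by (rule borel_measurable_mono)
  have m_cdf: "2 * m y = hitting_cdf (a - y) (r1 - r0)" if "y \<le> a" for y
  proof -
    have "m y = prob {\<omega>\<in>space M. Z \<omega> > a - y}"
      unfolding m_def by (subst measure_distr) (auto intro!: arg_cong[where f=prob])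
    then show ?thesis using normal_tail[OF Z, of "a - y"] r1 that by simp
  qed
  let ?f = "\<lambda>y. indicator {..a} y * (m y * normal_density 0 (sqrt r0) y)"
  have m0: "0 \<le> m y" for y by (simp add: m_def)
  have "{\<omega>\<in>space M. W r0 \<omega> \<le> a \<and> W r1 \<omega> > a} = (\<lambda>\<omega>. (W r0 \<omega>, Z \<omega>)) -` ?S \<inter> space M"
    by (auto simp: Z_def space_pair_measure)
  then have "emeasure M {\<omega>\<in>space M. W r0 \<omega> \<le> a \<and> W r1 \<omega> > a} = emeasure (distr M (borel \<Otimes>\<^sub>M borel) (\<lambda>\<omega>. (W r0 \<omega>, Z \<omega>))) ?S"
    by (subst emeasure_distr) auto
  also have "\<dots> = emeasure (?\<mu> \<Otimes>\<^sub>M ?\<nu>) ?S"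
    using ind unfolding indep_var_distribution_eq by simp
  also have "\<dots> = (\<integral>\<^sup>+y. emeasure ?\<nu> (Pair y -` ?S) \<partial>?\<mu>)"
  proof (rule \<nu>.emeasure_pair_measure_alt)
    show "?S \<in> sets (?\<mu> \<Otimes>\<^sub>M ?\<nu>)" using S by (simp cong: sets_pair_measure_cong)
  qed
  also have "\<dots> = (\<integral>\<^sup>+y. ennreal (indicator {..a} y * m y) \<partial>?\<mu>)"
  proof (rule nn_integral_cong)
    fix y
    have "Pair y -` ?S = (if y \<le> a then {a - y<..} else {})"
      by (auto simp: space_pair_measure algebra_simps)
    then show "emeasure ?\<nu> (Pair y -` ?S) = ennreal (indicator {..a} y * m y)"
      by (simp add: m_def \<nu>.emeasure_eq_measure)
  qed
  also have "\<dots> = (\<integral>\<^sup>+\<omega>. ennreal (indicator {..a} (W r0 \<omega>) * m (W r0 \<omega>)) \<partial>M)"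
    by (subst nn_integral_distr) auto
  also have "\<dots> = (\<integral>\<^sup>+y. ennreal (normal_density 0 (sqrt r0) y) * ennreal (indicator {..a} y * m y) \<partial>lborel)"
    by (rule distributed_nn_integral[OF start, symmetric]) measurable
  also have "\<dots> = (\<integral>\<^sup>+y. ennreal (?f y) \<partial>lborel)"
    using m0 by (intro nn_integral_cong) (simp add: mult_ac flip: ennreal_mult)
  finally have "prob {\<omega>\<in>space M. W r0 \<omega> \<le> a \<and> W r1 \<omega> > a} = enn2real (\<integral>\<^sup>+y. ennreal (?f y) \<partial>lborel)"
    by (simp add: measure_def)
  also have "\<dots> = integral\<^sup>L lborel ?f"
    using m0 by (intro integral_eq_nn_integral[symmetric]) auto
  finally have "2 * prob {\<omega>\<in>space M. W r0 \<omega> \<le> a \<and> W r1 \<omega> > a} = integral\<^sup>L lborel (\<lambda>y. 2 * ?f y)"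
    by simp
  also have "\<dots> = (LINT y:{..a}|lborel. hitting_cdf (a - y) (r1 - r0) * normal_density 0 (sqrt r0) y)"
    unfolding set_lebesgue_integral_def
    using m_cdf by (intro Bochner_Integration.integral_cong) (auto simp: indicator_def simp flip: m_cdf)
  finally show ?thesis .
qed

lemma exceeds_from_below:
  obtains A where "A \<in> events" and "A \<subseteq> {\<omega>\<in>space M. W r0 \<omega> \<le> a}"
    and "AE \<omega> in M. \<omega> \<in> A \<longleftrightarrow> W r0 \<omega> \<le> a \<and> (\<exists>r\<in>{r0..r1}. W r \<omega> > a)"
    and "prob A = (LINT y:{..a}|lborel. hitting_cdf (a - y) (r1 - r0) * normal_density 0 (sqrt r0) y)"
proof -
  obtain A where A: "A \<in> events" "AE \<omega> in M. \<omega> \<in> A \<longleftrightarrow> W r0 \<omega> \<le> a \<and> (\<exists>r\<in>{r0..r1}. W r \<omega> > a)"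
    "prob A = 2 * prob {\<omega>\<in>space M. W r0 \<omega> \<le> a \<and> W r1 \<omega> > a}"
  proof (rule reflection_principle[OF r1 W_measurable cont indep])
    show "distr M borel (\<lambda>\<omega>. - (W r \<omega> - W s \<omega>)) = distr M borel (\<lambda>\<omega>. W r \<omega> - W s \<omega>)"
      if "r0 \<le> s" "s < r" "r \<le> r1" for s r
      using normal_distr_symmetric[OF incr[OF that]] that by simp
  qed
  define B where "B = A \<inter> {\<omega>\<in>space M. W r0 \<omega> \<le> a}"
  have B: "B \<in> events" unfolding B_def using A(1) by measurable
  have AB: "AE \<omega> in M. \<omega> \<in> B \<longleftrightarrow> \<omega> \<in> A"
    using A(2) AE_space by eventually_elim (auto simp: B_def)
  have "prob B = prob A" using A(1) B AB by (intro finite_measure_eq_AE) auto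
  moreover have "AE \<omega> in M. \<omega> \<in> B \<longleftrightarrow> W r0 \<omega> \<le> a \<and> (\<exists>r\<in>{r0..r1}. W r \<omega> > a)"
    using A(2) AB by eventually_elim simp
  ultimately show thesis
    using that[of B] B A(3) prob_start_below_end_above[of a] by (auto simp: B_def)
qed

lemma falls_from_above:
  obtains A where "A \<in> events" and "A \<subseteq> {\<omega>\<in>space M. W r0 \<omega> \<ge> a}"
    and "AE \<omega> in M. \<omega> \<in> A \<longleftrightarrow> W r0 \<omega> \<ge> a \<and> (\<exists>r\<in>{r0..r1}. W r \<omega> < a)"
    and "prob A = (LINT y:{a..}|lborel. hitting_cdf (a - y) (r1 - r0) * normal_density 0 (sqrt r0) y)"
proof -
  interpret neg: brownian_segment M "\<lambda>r \<omega>. - W r \<omega>" r0 r1 by (rule brownian_segment_uminus)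
  obtain A where A: "A \<in> events" "A \<subseteq> {\<omega>\<in>space M. - W r0 \<omega> \<le> - a}"
    "AE \<omega> in M. \<omega> \<in> A \<longleftrightarrow> - W r0 \<omega> \<le> - a \<and> (\<exists>r\<in>{r0..r1}. - W r \<omega> > - a)"
    "prob A = (LINT y:{..- a}|lborel. hitting_cdf (- a - y) (r1 - r0) * normal_density 0 (sqrt r0) y)"
    by (rule neg.exceeds_from_below)
  have cdf: "hitting_cdf (y - a) s = hitting_cdf (a - y) s" for y s
    using hitting_cdf_uminus[of "a - y" s] by simp
  have "(LINT y:{..- a}|lborel. hitting_cdf (- a - y) (r1 - r0) * normal_density 0 (sqrt r0) y) =
      (LINT y:{y. - y \<in> {..- a}}|lborel. hitting_cdf (- a - - y) (r1 - r0) * normal_density 0 (sqrt r0) (- y))"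
    by (rule set_integral_reflect)
  also have "{y. - y \<in> {..- a}} = {a..}" by auto
  finally show thesis
    using that[of A] A by (simp add: cdf normal_density_0_uminus)
qed

text \<open>
  By the intermediate value theorem, a path that starts at or below \<open>\<alpha>\<close> and exceeds \<open>\<alpha>\<close> passes through
  \<open>(\<alpha>, \<beta>)\<close>, even if it is at \<open>\<beta>\<close> or above at the time in question; likewise from above.
\<close>

lemma prob_visits_interval:
  assumes ab: "\<alpha> < \<beta>"
  obtains E where "E \<in> events" and "AE \<omega> in M. \<omega> \<in> E \<longleftrightarrow> (\<exists>r\<in>{r0..r1}. \<alpha> < W r \<omega> \<and> W r \<omega> < \<beta>)"
    and "prob E =
        (LINT y:{..\<alpha>}|lborel. hitting_cdf (\<alpha> - y) (r1 - r0) * normal_density 0 (sqrt r0) y)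
      + (LINT y:{\<alpha>..\<beta>}|lborel. normal_density 0 (sqrt r0) y)
      + (LINT y:{\<beta>..}|lborel. hitting_cdf (\<beta> - y) (r1 - r0) * normal_density 0 (sqrt r0) y)"
proof -
  obtain A where A: "A \<in> events" "A \<subseteq> {\<omega>\<in>space M. W r0 \<omega> \<le> \<alpha>}"
    "AE \<omega> in M. \<omega> \<in> A \<longleftrightarrow> W r0 \<omega> \<le> \<alpha> \<and> (\<exists>r\<in>{r0..r1}. W r \<omega> > \<alpha>)"
    "prob A = (LINT y:{..\<alpha>}|lborel. hitting_cdf (\<alpha> - y) (r1 - r0) * normal_density 0 (sqrt r0) y)"
    by (rule exceeds_from_below)
  obtain C where C: "C \<in> events" "C \<subseteq> {\<omega>\<in>space M. W r0 \<omega> \<ge> \<beta>}"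
    "AE \<omega> in M. \<omega> \<in> C \<longleftrightarrow> W r0 \<omega> \<ge> \<beta> \<and> (\<exists>r\<in>{r0..r1}. W r \<omega> < \<beta>)"
    "prob C = (LINT y:{\<beta>..}|lborel. hitting_cdf (\<beta> - y) (r1 - r0) * normal_density 0 (sqrt r0) y)"
    by (rule falls_from_above)
  define B where "B = {\<omega>\<in>space M. \<alpha> < W r0 \<omega> \<and> W r0 \<omega> < \<beta>}"
  have B: "B \<in> events" unfolding B_def by measurable
  have "AE \<omega> in M. \<omega> \<in> B \<longleftrightarrow> \<omega> \<in> {\<omega>\<in>space M. W r0 \<omega> \<in> {\<alpha>..\<beta>}}"
    using normal_AE_neq[OF start, of \<alpha>] normal_AE_neq[OF start, of \<beta>]
    by eventually_elim (auto simp: B_def)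
  then have "prob B = prob {\<omega>\<in>space M. W r0 \<omega> \<in> {\<alpha>..\<beta>}}"
    using B by (intro finite_measure_eq_AE) auto
  then have pB: "prob B = (LINT y:{\<alpha>..\<beta>}|lborel. normal_density 0 (sqrt r0) y)"
    using normal_prob_set_integral[OF start, of "{\<alpha>..\<beta>}"] by simp
  have "prob (A \<union> B \<union> C) = prob (A \<union> B) + prob C"
    by (rule finite_measure_Union) (use A(1,2) B C(1,2) ab in \<open>force simp: B_def\<close>)+
  also have "prob (A \<union> B) = prob A + prob B"
    by (rule finite_measure_Union) (use A(1,2) B in \<open>auto simp: B_def\<close>)
  finally have p: "prob (A \<union> B \<union> C) = prob A + prob B + prob C" .
  have "AE \<omega> in M. \<omega> \<in> A \<union> B \<union> C \<longleftrightarrow> (\<exists>r\<in>{r0..r1}. \<alpha> < W r \<omega> \<and> W r \<omega> < \<beta>)"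
    using A(3) C(3) cont AE_space
  proof eventually_elim
    case (elim \<omega>)
    have r0_in: "r0 \<in> {r0..r1}" using r1 by simp
    define \<gamma> where "\<gamma> = (\<alpha> + \<beta>) / 2"
    have \<gamma>: "\<alpha> < \<gamma>" "\<gamma> < \<beta>" using ab by (auto simp: \<gamma>_def)
    have sub: "continuous_on {r0..r} (\<lambda>r. W r \<omega>)" if "r \<in> {r0..r1}" for r
      using elim(3) by (rule continuous_on_subset) (use that in auto)
    show ?case
    proof
      assume "\<omega> \<in> A \<union> B \<union> C"
      then consider "\<omega> \<in> A" | "\<omega> \<in> B" | "\<omega> \<in> C" by blast
      then show "\<exists>r\<in>{r0..r1}. \<alpha> < W r \<omega> \<and> W r \<omega> < \<beta>"
      proof cases
        case 1
        then obtain r where r: "r \<in> {r0..r1}" "W r \<omega> > \<alpha>" "W r0 \<omega> \<le> \<alpha>" using elim(1) by auto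
        show ?thesis
        proof (cases "W r \<omega> < \<beta>")
          case False
          have "\<exists>q\<ge>r0. q \<le> r \<and> W q \<omega> = \<gamma>"
            by (rule IVT'[OF _ _ _ sub[OF r(1)]]) (use r False \<gamma> in auto)
          then show ?thesis using r \<gamma> by force
        qed (use r in auto)
      next
        case 2
        then show ?thesis using r0_in by (auto simp: B_def)
      next
        case 3
        then obtain r where r: "r \<in> {r0..r1}" "W r \<omega> < \<beta>" "W r0 \<omega> \<ge> \<beta>" using elim(2) by auto
        show ?thesis
        proof (cases "W r \<omega> > \<alpha>")
          case False
          have "\<exists>q\<ge>r0. q \<le> r \<and> W q \<omega> = \<gamma>"
            by (rule IVT2'[OF _ _ _ sub[OF r(1)]]) (use r False \<gamma> in auto)
          then show ?thesis using r \<gamma> by force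
        qed (use r in auto)
      qed
    next
      assume "\<exists>r\<in>{r0..r1}. \<alpha> < W r \<omega> \<and> W r \<omega> < \<beta>"
      then show "\<omega> \<in> A \<union> B \<union> C" using elim(1,2,4) by (auto simp: B_def)
    qed
  qed
  with p show thesis using that[of "A \<union> B \<union> C"] A(1,4) B C(1,4) pB by simp
qed

end

section \<open>The wave equation solution as a function of the propagation speed\<close>

lemma backward_triangle_mono: "c \<le> d \<Longrightarrow> backward_triangle x t c \<subseteq> backward_triangle x t d"
  using mult_right_mono[of c d "t - s" for s] by (fastforce simp: backward_triangle_def)

lemma backward_triangle_subset_D: "backward_triangle x t c \<subseteq> D"
  by (auto simp: backward_triangle_def D_def)

lemma backward_triangle_borel [measurable]: "backward_triangle x t c \<in> sets borel"
proof -
  have "closed {p. 0 \<le> snd p \<and> snd p \<le> t \<and> \<bar>fst p - x\<bar> \<le> c * (t - snd p)}"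
    by (intro closed_Collect_conj closed_Collect_le continuous_intros)
  also have "{p. 0 \<le> snd p \<and> snd p \<le> t \<and> \<bar>fst p - x\<bar> \<le> c * (t - snd p)} = backward_triangle x t c"
    by (auto simp: backward_triangle_def)
  finally show ?thesis by (rule borel_closed)
qed

lemma emeasure_backward_triangle:
  assumes "0 < t" "0 < c"
  shows "emeasure lborel (backward_triangle x t c) = ennreal (c * t\<^sup>2)"
proof -
  have "emeasure lborel (backward_triangle x t c) = emeasure (lborel \<Otimes>\<^sub>M lborel) (backward_triangle x t c)"
    by (simp add: lborel_prod)
  also have "\<dots> = (\<integral>\<^sup>+s. emeasure lborel ((\<lambda>y. (y, s)) -` backward_triangle x t c) \<partial>lborel)"
    by (rule lborel_pair.emeasure_pair_measure_alt2) (simp only: lborel_prod sets_lborel backward_triangle_borel)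
  also have "\<dots> = (\<integral>\<^sup>+s. ennreal (2 * c * (t - s)) * indicator {0..t} s \<partial>lborel)"
  proof (rule nn_integral_cong)
    fix s
    have "(\<lambda>y. (y, s)) -` backward_triangle x t c = (if s \<in> {0..t} then {x - c * (t - s)..x + c * (t - s)} else {})"
      by (auto simp: backward_triangle_def)
    then show "emeasure lborel ((\<lambda>y. (y, s)) -` backward_triangle x t c) = ennreal (2 * c * (t - s)) * indicator {0..t} s"
      using assms by (auto simp: emeasure_lborel_Icc_eq)
  qed
  also have "\<dots> = ennreal (2 * c * (t * t - t\<^sup>2 / 2) - 2 * c * (t * 0 - 0\<^sup>2 / 2))"
    by (rule nn_integral_FTC_Icc[where F="\<lambda>s. 2 * c * (t * s - s\<^sup>2 / 2)"])
       (use assms in \<open>auto intro!: derivative_eq_intros simp: algebra_simps\<close>)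
  also have "2 * c * (t * t - t\<^sup>2 / 2) - 2 * c * (t * 0 - 0\<^sup>2 / 2) = c * t\<^sup>2"
    by (simp add: power2_eq_square)
  finally show ?thesis .
qed

text \<open>
  White noise at this function is \<open>(2 / t) u\<^sub>c(x, t)\<close> for \<open>c = 1 / r\<close>. The factor \<open>r / t\<close> is
  \<open>(2 / t) (1 / (2 c))\<close>; written in this form the kernel vanishes at \<open>r = 0\<close>.
\<close>

definition wave_kernel :: "real \<Rightarrow> real \<Rightarrow> real \<Rightarrow> real \<times> real \<Rightarrow> real" where
  "wave_kernel x t r p = r / t * indicator (backward_triangle x t (1 / r)) p"

lemma wave_kernel_0 [simp]: "wave_kernel x t 0 p = 0"
  by (simp add: wave_kernel_def)

text \<open>
  The product of the indicators is the indicator of the smaller triangle, which belongs to \<open>max r q\<close> and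
  has area \<open>t\<^sup>2 / max r q\<close>.
\<close>

lemma wave_kernel_product_pos:
  assumes "0 < t" "0 < r" "0 < q"
  shows "set_integrable lborel D (\<lambda>p. wave_kernel x t r p * wave_kernel x t q p)" (is ?int)
    and "(LINT p:D|lborel. wave_kernel x t r p * wave_kernel x t q p) = min r q" (is ?eq)
proof -
  define m where "m = max r q"
  have m: "m > 0" using assms by (simp add: m_def)
  let ?T = "backward_triangle x t (1 / m)"
  have T: "backward_triangle x t (1 / r) \<inter> backward_triangle x t (1 / q) = ?T"
  proof (cases "r \<le> q")
    case True
    then have "backward_triangle x t (1 / q) \<subseteq> backward_triangle x t (1 / r)"
      using assms by (intro backward_triangle_mono) (simp add: frac_le)
    then show ?thesis using True by (auto simp: m_def max_def)
  next
    case False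
    then have "backward_triangle x t (1 / r) \<subseteq> backward_triangle x t (1 / q)"
      using assms by (intro backward_triangle_mono) (simp add: frac_le)
    then show ?thesis using False by (auto simp: m_def max_def)
  qed
  have eq: "indicator D p *\<^sub>R (wave_kernel x t r p * wave_kernel x t q p) = r * q / t\<^sup>2 * indicator ?T p" for p
    unfolding wave_kernel_def T[symmetric] using backward_triangle_subset_D[of x t]
    by (auto simp: indicator_def power2_eq_square)
  have em: "emeasure lborel ?T = ennreal (1 / m * t\<^sup>2)"
    using assms m by (intro emeasure_backward_triangle) auto
  then have "integrable lborel (indicator ?T :: _ \<Rightarrow> real)" by (intro integrable_real_indicator) auto
  then show ?int unfolding set_integrable_def eq by simp
  have "(LINT p:D|lborel. wave_kernel x t r p * wave_kernel x t q p) = r * q / t\<^sup>2 * measure lborel ?T"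
    unfolding set_lebesgue_integral_def eq by simp
  also have "measure lborel ?T = 1 / m * t\<^sup>2" using em m by (simp add: measure_def)
  also have "r * q / t\<^sup>2 * (1 / m * t\<^sup>2) = min r q"
    using assms by (auto simp: m_def max_def min_def)
  finally show ?eq .
qed

lemma wave_kernel_product:
  assumes "0 < t" "0 \<le> r" "0 \<le> q"
  shows "set_integrable lborel D (\<lambda>p. wave_kernel x t r p * wave_kernel x t q p)"
    and "(LINT p:D|lborel. wave_kernel x t r p * wave_kernel x t q p) = min r q"
  using wave_kernel_product_pos[of t r q x] assms
  by (cases "r = 0"; cases "q = 0"; simp add: set_integrable_def set_lebesgue_integral_def)+

lemma wave_kernel_increments_product:
  assumes "0 < t" "0 \<le> a" "0 \<le> b" "0 \<le> c" "0 \<le> d"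
  shows "(LINT p:D|lborel. (wave_kernel x t b p - wave_kernel x t a p) * (wave_kernel x t d p - wave_kernel x t c p)) =
    min b d - min b c - min a d + min a c"
proof -
  let ?k = "wave_kernel x t"
  note int = wave_kernel_product(1)[OF assms(1), of _ _ x]
  have "(LINT p:D|lborel. (?k b p - ?k a p) * (?k d p - ?k c p)) =
      (LINT p:D|lborel. ((?k b p * ?k d p - ?k b p * ?k c p) - ?k a p * ?k d p) + ?k a p * ?k c p)"
    by (simp add: algebra_simps)
  also have "\<dots> = (LINT p:D|lborel. ?k b p * ?k d p) - (LINT p:D|lborel. ?k b p * ?k c p) - (LINT p:D|lborel. ?k a p * ?k d p)
      + (LINT p:D|lborel. ?k a p * ?k c p)"
    using assms int by (subst set_integral_add set_integral_diff; (intro set_integral_diff int)?; simp)+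
  finally show ?thesis using assms by (simp add: wave_kernel_product)
qed

text \<open>
  The covariance \<open>min r q\<close> of the kernels is that of Brownian motion, so increments over disjoint time
  intervals are orthogonal, and hence independent.
\<close>

lemma wave_solution_brownian_segment:
  assumes P: "white_noise_measure P" and t: "0 < t" and c: "0 < c_lo" "c_lo < c_hi"
    and sol: "\<And>c. c > 0 \<Longrightarrow> wave_solution_at P c x t (v c)"
    and v_cont: "AE \<omega> in completion P. continuous_on {0<..} (\<lambda>c. v c \<omega>)"
  shows "brownian_segment (completion P) (\<lambda>r \<omega>. 2 / t * v (1 / r) \<omega>) (1 / c_hi) (1 / c_lo)"
proof -
  have "prob_space P" using P by (simp add: white_noise_measure_def)
  then interpret prob_space "completion P" by (rule prob_space_completion)
  define W where "W = (\<lambda>r \<omega>. 2 / t * v (1 / r) \<omega>)"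
  define r0 r1 where "r0 = 1 / c_hi" and "r1 = 1 / c_lo"
  let ?k = "wave_kernel x t"
  have r: "0 < r0" "r0 < r1" using c by (auto simp: r0_def r1_def frac_less2)
  have pair: "white_noise_pairing P (?k r) (W r)" if "r > 0" for r
  proof -
    let ?f = "\<lambda>p. 1 / (2 * (1 / r)) * indicator (backward_triangle x t (1 / r)) p :: real"
    have f: "white_noise_pairing P ?f (v (1 / r))"
      using sol[of "1 / r"] that by (simp add: wave_solution_at_def)
    have "white_noise_pairing P (\<lambda>p. 2 / t * ?f p + 0 * ?f p) (\<lambda>\<omega>. 2 / t * v (1 / r) \<omega> + 0 * v (1 / r) \<omega>)"
      by (rule white_noise_pairing_lincomb[OF P f f])
    also have "(\<lambda>p. 2 / t * ?f p + 0 * ?f p) = ?k r" by (simp add: wave_kernel_def fun_eq_iff)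
    finally show ?thesis by (simp add: W_def)
  qed
  have pair_incr: "white_noise_pairing P (\<lambda>p. ?k r p - ?k q p) (\<lambda>\<omega>. W r \<omega> - W q \<omega>)" if "0 < r" "0 < q" for r q
    using white_noise_pairing_lincomb[OF P pair[OF that(1)] pair[OF that(2)], of 1 "-1"] by simp
  have "brownian_segment (completion P) W r0 r1"
  proof unfold_locales
    show "AE \<omega> in completion P. continuous_on {r0..r1} (\<lambda>r. W r \<omega>)"
      using v_cont
    proof eventually_elim
      case (elim \<omega>)
      have "continuous_on {r0..r1} (\<lambda>r. v (1 / r) \<omega>)"
        by (rule continuous_on_compose2[OF elim]) (use r in \<open>auto intro!: continuous_intros\<close>)
      then show ?case unfolding W_def by (intro continuous_intros)
    qed
    show "distributed (completion P) lborel (W r0) (normal_density 0 (sqrt r0))"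
      using wave_kernel_product(2)[OF t, of r0 r0 x] r
      by (intro white_noise_pairing_normal[OF P pair]) (auto simp: power2_eq_square)
    show "distributed (completion P) lborel (\<lambda>\<omega>. W r \<omega> - W q \<omega>) (normal_density 0 (sqrt (r - q)))"
      if "r0 \<le> q" "q < r" "r \<le> r1" for q r
      using wave_kernel_increments_product[OF t, of q r q r x] that \<open>0 < r0\<close>
      by (intro white_noise_pairing_normal[OF P pair_incr]) (auto simp: power2_eq_square)
    fix n :: nat assume n: "n > 0"
    define \<rho> where "\<rho> = (\<lambda>i. r0 + (r1 - r0) * (real i / real n))"
    \<comment> \<open>Since the kernel vanishes at 0, the starting value is an increment from 0, too.\<close>
    define \<sigma> where "\<sigma> = (\<lambda>i. if i = 0 then 0 else \<rho> (i - 1))"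
    have \<rho>_mono: "\<rho> i \<le> \<rho> j" if "i \<le> j" for i j
      unfolding \<rho>_def using that r n by (intro add_left_mono mult_left_mono divide_right_mono) auto
    have \<rho>0: "\<rho> 0 = r0" by (simp add: \<rho>_def)
    have \<rho>_pos: "\<rho> i > 0" for i using \<rho>_mono[of 0 i] r by (simp add: \<rho>0)
    have \<sigma>_nonneg: "\<sigma> i \<ge> 0" and \<sigma>\<rho>: "\<sigma> i \<le> \<rho> i" for i
      using \<rho>_pos[of i] \<rho>_pos[of "i - 1"] \<rho>_mono[of "i - 1" i] by (auto simp: \<sigma>_def)
    have "indep_vars (\<lambda>_. borel) (\<lambda>i \<omega>. if i = 0 then W r0 \<omega> else W (\<rho> i) \<omega> - W (\<rho> (i - 1)) \<omega>) {..n}"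
    proof (rule white_noise_pairing_indep[OF P])
      show "white_noise_pairing P (\<lambda>p. ?k (\<rho> i) p - ?k (\<sigma> i) p)
          (\<lambda>\<omega>. if i = 0 then W r0 \<omega> else W (\<rho> i) \<omega> - W (\<rho> (i - 1)) \<omega>)" for i
        using pair[OF \<open>0 < r0\<close>] pair_incr[OF \<rho>_pos[of i] \<rho>_pos[of "i - 1"]] by (cases "i = 0") (auto simp: \<sigma>_def \<rho>0)
      have orth: "(LINT p:D|lborel. (?k (\<rho> i) p - ?k (\<sigma> i) p) * (?k (\<rho> j) p - ?k (\<sigma> j) p)) = 0" if ij: "i < j" for i j
      proof -
        have le: "\<rho> i \<le> \<sigma> j" using ij \<rho>_mono[of i "j - 1"] by (auto simp: \<sigma>_def)
        have "(LINT p:D|lborel. (?k (\<rho> i) p - ?k (\<sigma> i) p) * (?k (\<rho> j) p - ?k (\<sigma> j) p)) =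
            min (\<rho> i) (\<rho> j) - min (\<rho> i) (\<sigma> j) - min (\<sigma> i) (\<rho> j) + min (\<sigma> i) (\<sigma> j)"
          using \<rho>_pos \<sigma>_nonneg by (intro wave_kernel_increments_product t) (auto intro: less_imp_le)
        also have "\<dots> = 0" using le \<sigma>\<rho>[of i] \<sigma>\<rho>[of j] by (simp add: min_def)
        finally show ?thesis .
      qed
      show "(LINT p:D|lborel. (?k (\<rho> i) p - ?k (\<sigma> i) p) * (?k (\<rho> j) p - ?k (\<sigma> j) p)) = 0" if "i \<noteq> j" for i j
        using orth[of i j] orth[of j i] that by (cases i j rule: linorder_cases) (auto simp: mult.commute)
    qed auto
    then show "indep_vars (\<lambda>_. borel) (\<lambda>i \<omega>. if i = 0 then W r0 \<omega>
        else W (r0 + (r1 - r0) * (real i / real n)) \<omega> - W (r0 + (r1 - r0) * (real (i - 1) / real n)) \<omega>) {..n}"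
      unfolding \<rho>_def .
  qed (use r in auto)
  then show ?thesis by (simp add: W_def r0_def r1_def)
qed

theorem mainTheorem4:
  fixes P :: "distribution measure"
    and u :: "real \<Rightarrow> real \<Rightarrow> real \<Rightarrow> distribution \<Rightarrow> real"
    and t x c_lo c_hi b_lo b_hi r_lo r_hi :: real
    and g :: "real \<Rightarrow> real"
    and X :: "distribution \<Rightarrow> real set"
  assumes "white_noise_measure P"
    and "t > 0" and "0 < c_lo" and "c_lo < c_hi" and "b_lo < b_hi"
    and "\<And>c. c > 0 \<Longrightarrow> wave_solution_at P c x t (u c x t)"
    and "AE \<omega> in completion P. continuous_on {0<..} (\<lambda>c. u c x t \<omega>)"
  defines "X \<equiv> \<lambda>\<omega>. {u c x t \<omega> | c. c_lo \<le> c \<and> c \<le> c_hi}"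
    and "r_lo \<equiv> 1 / c_hi" and "r_hi \<equiv> 1 / c_lo"
    and "g \<equiv> \<lambda>y. 1 / sqrt (2 * pi * r_lo) * exp (- y\<^sup>2 / (2 * r_lo))"
  shows "upper_probability (completion P) X {b_lo<..<b_hi} =
             (LINT y:{..2 / t * b_lo}|lborel. hitting_cdf (2 / t * b_lo - y) (r_hi - r_lo) * g y)
           + (LINT y:{2 / t * b_lo..2 / t * b_hi}|lborel. g y)
           + (LINT y:{2 / t * b_hi..}|lborel. hitting_cdf (2 / t * b_hi - y) (r_hi - r_lo) * g y)
         \<and> (\<forall>(Q :: 'w measure) w a s. brownian_motion Q w \<and> s > 0 \<longrightarrow>
              measure (completion Q) {\<omega> \<in> space Q. hitting_time w a \<omega> \<le> ereal s} = hitting_cdf a s)"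
proof (intro conjI allI impI)
  define W where "W = (\<lambda>r \<omega>. 2 / t * u (1 / r) x t \<omega>)"
  interpret brownian_segment "completion P" W r_lo r_hi
    unfolding W_def r_lo_def r_hi_def
    by (rule wave_solution_brownian_segment[OF assms(1-4), of x "\<lambda>c. u c x t"]) (use assms(6,7) in auto)
  have g: "g = normal_density 0 (sqrt r_lo)"
    using r0 by (simp add: g_def normal_density_def fun_eq_iff)
  have "2 / t * b_lo < 2 / t * b_hi" using assms(2,5) by (simp add: divide_strict_right_mono)
  then obtain E where E: "E \<in> events"
    "AE \<omega> in completion P. \<omega> \<in> E \<longleftrightarrow> (\<exists>r\<in>{r_lo..r_hi}. 2 / t * b_lo < W r \<omega> \<and> W r \<omega> < 2 / t * b_hi)"
    "prob E = (LINT y:{..2 / t * b_lo}|lborel. hitting_cdf (2 / t * b_lo - y) (r_hi - r_lo) * g y)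
           + (LINT y:{2 / t * b_lo..2 / t * b_hi}|lborel. g y)
           + (LINT y:{2 / t * b_hi..}|lborel. hitting_cdf (2 / t * b_hi - y) (r_hi - r_lo) * g y)"
    unfolding g by (rule prob_visits_interval)
  have iff: "X \<omega> \<inter> {b_lo<..<b_hi} \<noteq> {} \<longleftrightarrow> (\<exists>r\<in>{r_lo..r_hi}. 2 / t * b_lo < W r \<omega> \<and> W r \<omega> < 2 / t * b_hi)" for \<omega>
  proof -
    have "{c_lo..c_hi} = (\<lambda>r. 1 / r) ` {r_lo..r_hi}"
    proof (intro equalityI subsetI)
      fix c assume "c \<in> {c_lo..c_hi}"
      then show "c \<in> (\<lambda>r. 1 / r) ` {r_lo..r_hi}"
        using assms(3) by (intro image_eqI[of _ _ "1 / c"]) (auto simp: r_lo_def r_hi_def frac_le)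
    next
      fix c assume "c \<in> (\<lambda>r. 1 / r) ` {r_lo..r_hi}"
      then obtain r where r: "c = 1 / r" "1 / c_hi \<le> r" "r \<le> 1 / c_lo" by (auto simp: r_lo_def r_hi_def)
      have "0 < 1 / c_hi" using assms(3,4) by simp
      then have "0 < r" using r(2) by linarith
      then have "c_lo \<le> 1 / r" "1 / r \<le> c_hi" using r(2,3) assms(3,4) by (simp_all add: field_simps)
      then show "c \<in> {c_lo..c_hi}" using r(1) by simp
    qed
    then have "X \<omega> = (\<lambda>r. u (1 / r) x t \<omega>) ` {r_lo..r_hi}"
      unfolding X_def by (auto simp: image_iff set_eq_iff)
    moreover have "b_lo < z \<longleftrightarrow> 2 / t * b_lo < 2 / t * z" "z < b_hi \<longleftrightarrow> 2 / t * z < 2 / t * b_hi" for z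
      using assms(2) by (simp_all add: divide_less_cancel)
    ultimately show ?thesis by (auto simp: W_def)
  qed
  let ?S = "{\<omega> \<in> space (completion P). X \<omega> \<inter> {b_lo<..<b_hi} \<noteq> {}}"
  have ae: "AE \<omega> in completion P. \<omega> \<in> E \<longleftrightarrow> \<omega> \<in> ?S"
    using E(2) AE_space by eventually_elim (simp only: iff mem_Collect_eq simp_thms)
  have "?S \<in> events" by (rule completion.in_sets_AE[OF ae E(1)]) auto
  then have "prob ?S = prob E" using E(1) ae by (intro finite_measure_eq_AE) (auto elim: eventually_mono)
  then show "upper_probability (completion P) X {b_lo<..<b_hi} =
             (LINT y:{..2 / t * b_lo}|lborel. hitting_cdf (2 / t * b_lo - y) (r_hi - r_lo) * g y)
           + (LINT y:{2 / t * b_lo..2 / t * b_hi}|lborel. g y)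
           + (LINT y:{2 / t * b_hi..}|lborel. hitting_cdf (2 / t * b_hi - y) (r_hi - r_lo) * g y)"
    by (simp only: upper_probability_def E(3))
next
  fix Q :: "'w measure" and w and a s :: real
  assume "brownian_motion Q w \<and> s > 0"
  then show "measure (completion Q) {\<omega> \<in> space Q. hitting_time w a \<omega> \<le> ereal s} = hitting_cdf a s"
    by (intro hitting_time_distribution) auto
qed

end
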